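(* (Positive compactness theorem.) Let $T$ be a set of positive $\mathcal{L}$-sentences. If $T$ is uniformly finitely $\mathcal{L}$-consistent, then $T$ is standardly consistent, i.e. there is a standard structure $M$ with $M\models T$.
   Context: Fix a compact Hausdorff space $S$. $\mathcal{L}_{\sf S}$ is the first-order language having a relation symbol for every compact $C\subseteq S^n$ ($n\ge 1$) and a function symbol for every continuous $f:S^n\to S$ (in particular a constant for each point of $S$); $S$ is an $\mathcal{L}_{\sf S}$-structure in the obvious way. $\mathcal{L}_{\sf H}$ is a fixed first-order language. $\mathcal{L}$ is a two-sorted language, with sorts ${\sf H}$ (home sort) and ${\sf S}$, expanding $\mathcal{L}_{\sf H}$ on ${\sf H}$ and $\mathcal{L}_{\sf S}$ on ${\sf S}$, possibly with further function symbols of sorts ${\sf H}^n\times{\sf S}^m\to{\sf S}$, and with a relation symbol $r_\varphi(x)$ for every $\mathcal{L}_{\sf H}$-formula $\varphi(x)$. An $\mathcal{L}$-structure is a two-sorted structure $\langle M,{}^*S\rangle$ of signature $\mathcal{L}$ satisfying $r_\varphi(x)\leftrightarrow\varphi(x)$ for all $\varphi\in\mathcal{L}_{\sf H}$, in which every function symbol $f$ of sort ${\sf H}^n\times{\sf S}^m\to{\sf S}$ is equicontinuous: for every compact neighbourhood $\varepsilon$ of the diagonal of $S^2$ there is a compact neighbourhood $\delta$ of the diagonal of $(S^m)^2$ such that $\forall x\,\forall\eta,\eta'\,(\langle\eta,\eta'\rangle\in\delta\to\langle f(x,\eta),f(x,\eta')\rangle\in\varepsilon)$ holds in the structure; a map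 $\varepsilon\mapsto\delta$ with this property (for all such $f$) is a modulus of equicontinuity. A standard structure is an $\mathcal{L}$-structure $\langle M,S\rangle$ whose ${\sf S}$-sort is $S$ itself with its canonical interpretation of $\mathcal{L}_{\sf S}$. Up to equivalence, atomic formulas are $r_\varphi(x)$ and $\tau(x;\eta)\in C$ with $\tau$ an $n$-tuple of terms of sort ${\sf S}$ and $C\subseteq S^n$ compact. A formula is positive if it is built from atomic formulas using only $\wedge,\vee$ and the quantifiers $\forall,\exists$ of both sorts. $T$ is $\mathcal{L}$-consistent if it has a model that is an $\mathcal{L}$-structure. $T$ is uniformly finitely $\mathcal{L}$-consistent if every finite $T_0\subseteq T$ has a model that is an $\mathcal{L}$-structure, and these witnessing $\mathcal{L}$-structures can be chosen with a common modulus of equicontinuity.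
   Formalization: In an L-structure ⟨M,*S⟩ the sort *S is additionally required to be elementarily equivalent to S in L_S (i.e. an elementary extension of S up to isomorphism); without this the claim fails, e.g. for S={c,d} discrete and T={c∈{d}}. *)

theory Defs
  imports "HOL-Analysis.Analysis"
begin

section \<open>One-sorted first-order logic\<close>

text \<open>Used twice: for the language of the home sort, and for the language of the compact space.
  Symbols are drawn from types; a language singles out the sets of symbols it has.\<close>

datatype 'f tm = Var nat | Fn 'f "'f tm list"

datatype ('f, 'p) fm =
    Eq "'f tm" "'f tm"
  | Rel 'p "'f tm list"
  | Neg "('f, 'p) fm"
  | Conj "('f, 'p) fm" "('f, 'p) fm"
  | Disj "('f, 'p) fm" "('f, 'p) fm"
  | Forall nat "('f, 'p) fm"
  | Exists nat "('f, 'p) fm"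

record ('f, 'p) fo_lang =
  funs :: "'f set"
  fun_ar :: "'f \<Rightarrow> nat"
  rels :: "'p set"
  rel_ar :: "'p \<Rightarrow> nat"

fun wf_tm :: "('f, 'p) fo_lang \<Rightarrow> 'f tm \<Rightarrow> bool" where
  "wf_tm L (Var x) \<longleftrightarrow> True"
| "wf_tm L (Fn f ts) \<longleftrightarrow> f \<in> funs L \<and> length ts = fun_ar L f \<and> (\<forall>t\<in>set ts. wf_tm L t)"

fun fv_tm :: "'f tm \<Rightarrow> nat set" where
  "fv_tm (Var x) = {x}"
| "fv_tm (Fn f ts) = (\<Union>t\<in>set ts. fv_tm t)"

fun wf_fm :: "('f, 'p) fo_lang \<Rightarrow> ('f, 'p) fm \<Rightarrow> bool" where
  "wf_fm L (Eq s t) \<longleftrightarrow> wf_tm L s \<and> wf_tm L t"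
| "wf_fm L (Rel p ts) \<longleftrightarrow> p \<in> rels L \<and> length ts = rel_ar L p \<and> (\<forall>t\<in>set ts. wf_tm L t)"
| "wf_fm L (Neg \<phi>) \<longleftrightarrow> wf_fm L \<phi>"
| "wf_fm L (Conj \<phi> \<psi>) \<longleftrightarrow> wf_fm L \<phi> \<and> wf_fm L \<psi>"
| "wf_fm L (Disj \<phi> \<psi>) \<longleftrightarrow> wf_fm L \<phi> \<and> wf_fm L \<psi>"
| "wf_fm L (Forall x \<phi>) \<longleftrightarrow> wf_fm L \<phi>"
| "wf_fm L (Exists x \<phi>) \<longleftrightarrow> wf_fm L \<phi>"

fun fv_fm :: "('f, 'p) fm \<Rightarrow> nat set" where
  "fv_fm (Eq s t) = fv_tm s \<union> fv_tm t"
| "fv_fm (Rel p ts) = (\<Union>t\<in>set ts. fv_tm t)"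
| "fv_fm (Neg \<phi>) = fv_fm \<phi>"
| "fv_fm (Conj \<phi> \<psi>) = fv_fm \<phi> \<union> fv_fm \<psi>"
| "fv_fm (Disj \<phi> \<psi>) = fv_fm \<phi> \<union> fv_fm \<psi>"
| "fv_fm (Forall x \<phi>) = fv_fm \<phi> - {x}"
| "fv_fm (Exists x \<phi>) = fv_fm \<phi> - {x}"

record ('f, 'p, 'a) fo_struct =
  univ :: "'a set"
  fun_int :: "'f \<Rightarrow> 'a list \<Rightarrow> 'a"
  rel_int :: "'p \<Rightarrow> 'a list \<Rightarrow> bool"

definition fo_structure :: "('f, 'p) fo_lang \<Rightarrow> ('f, 'p, 'a) fo_struct \<Rightarrow> bool" where
  "fo_structure L A \<longleftrightarrow> univ A \<noteq> {} \<and>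
     (\<forall>f\<in>funs L. \<forall>as. length as = fun_ar L f \<and> set as \<subseteq> univ A \<longrightarrow> fun_int A f as \<in> univ A)"

fun tm_val :: "('f, 'p, 'a) fo_struct \<Rightarrow> (nat \<Rightarrow> 'a) \<Rightarrow> 'f tm \<Rightarrow> 'a" where
  "tm_val A v (Var x) = v x"
| "tm_val A v (Fn f ts) = fun_int A f (map (tm_val A v) ts)"

fun fm_sat :: "('f, 'p, 'a) fo_struct \<Rightarrow> (nat \<Rightarrow> 'a) \<Rightarrow> ('f, 'p) fm \<Rightarrow> bool" where
  "fm_sat A v (Eq s t) \<longleftrightarrow> tm_val A v s = tm_val A v t"
| "fm_sat A v (Rel p ts) \<longleftrightarrow> rel_int A p (map (tm_val A v) ts)"
| "fm_sat A v (Neg \<phi>) \<longleftrightarrow> \<not> fm_sat A v \<phi>"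
| "fm_sat A v (Conj \<phi> \<psi>) \<longleftrightarrow> fm_sat A v \<phi> \<and> fm_sat A v \<psi>"
| "fm_sat A v (Disj \<phi> \<psi>) \<longleftrightarrow> fm_sat A v \<phi> \<or> fm_sat A v \<psi>"
| "fm_sat A v (Forall x \<phi>) \<longleftrightarrow> (\<forall>a\<in>univ A. fm_sat A (v(x := a)) \<phi>)"
| "fm_sat A v (Exists x \<phi>) \<longleftrightarrow> (\<exists>a\<in>univ A. fm_sat A (v(x := a)) \<phi>)"

definition fo_models :: "('f, 'p, 'a) fo_struct \<Rightarrow> ('f, 'p) fm \<Rightarrow> bool" where
  "fo_models A \<phi> \<longleftrightarrow> (\<forall>v. range v \<subseteq> univ A \<longrightarrow> fm_sat A v \<phi>)"

definition elem_equiv ::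
  "('f, 'p) fo_lang \<Rightarrow> ('f, 'p, 'a) fo_struct \<Rightarrow> ('f, 'p, 'b) fo_struct \<Rightarrow> bool" where
  "elem_equiv L A B \<longleftrightarrow>
     (\<forall>\<phi>. wf_fm L \<phi> \<and> fv_fm \<phi> = {} \<longrightarrow> (fo_models A \<phi> \<longleftrightarrow> fo_models B \<phi>))"


section \<open>The language and the structure of a compact space\<close>

definition space_pow :: "'s topology \<Rightarrow> nat \<Rightarrow> (nat \<Rightarrow> 's) topology" where
  "space_pow S n = product_topology (\<lambda>_. S) {..<n}"

definition tuple :: "'s list \<Rightarrow> nat \<Rightarrow> 's" where
  "tuple xs = restrict (\<lambda>i. xs ! i) {..<length xs}"

type_synonym 's cont_sym = "nat \<times> ((nat \<Rightarrow> 's) \<Rightarrow> 's)"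
type_synonym 's comp_sym = "nat \<times> (nat \<Rightarrow> 's) set"

text \<open>Extensionality makes the function symbols correspond one-to-one to the continuous maps
  from a power of the space to the space.\<close>

definition space_lang :: "'s topology \<Rightarrow> ('s cont_sym, 's comp_sym) fo_lang" where
  "space_lang S = \<lparr>
     funs = {(n, f). continuous_map (space_pow S n) S f \<and> f \<in> extensional (topspace (space_pow S n))},
     fun_ar = fst,
     rels = {(n, C). 1 \<le> n \<and> compactin (space_pow S n) C},
     rel_ar = fst\<rparr>"

definition space_struct :: "'s topology \<Rightarrow> ('s cont_sym, 's comp_sym, 's) fo_struct" where
  "space_struct S = \<lparr>
     univ = topspace S,
     fun_int = (\<lambda>(n, f) xs. f (tuple xs)),
     rel_int = (\<lambda>(n, C) xs. tuple xs \<in> C)\<rparr>"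

text \<open>The square of the \<open>m\<close>-th power is identified with the power \<open>2 * m\<close>, a pair of
  \<open>m\<close>-tuples being their concatenation.\<close>

definition diagonal :: "'s topology \<Rightarrow> nat \<Rightarrow> (nat \<Rightarrow> 's) set" where
  "diagonal S m = {a \<in> topspace (space_pow S (2 * m)). \<forall>i<m. a i = a (m + i)}"

definition compact_diag_nbhd :: "'s topology \<Rightarrow> nat \<Rightarrow> (nat \<Rightarrow> 's) set \<Rightarrow> bool" where
  "compact_diag_nbhd S m C \<longleftrightarrow>
     compactin (space_pow S (2 * m)) C \<and> diagonal S m \<subseteq> space_pow S (2 * m) interior_of C"


section \<open>The two-sorted language\<close>

text \<open>Function symbols with values in the sort of the space: those of the language of the space,
  and the further ones, which also take arguments of the home sort.\<close>

datatype ('g, 's) ssym = Cont "'s cont_sym" | Further 'g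

record ('f, 'p, 'g) lang =
  home_lang :: "('f, 'p) fo_lang"
  further :: "'g set"
  further_ar :: "'g \<Rightarrow> nat \<times> nat"

definition ssyms :: "'s topology \<Rightarrow> ('f, 'p, 'g) lang \<Rightarrow> ('g, 's) ssym set" where
  "ssyms S L = Cont ` funs (space_lang S) \<union> Further ` further L"

fun home_ar :: "('f, 'p, 'g) lang \<Rightarrow> ('g, 's) ssym \<Rightarrow> nat" where
  "home_ar L (Cont c) = 0"
| "home_ar L (Further g) = fst (further_ar L g)"

fun space_ar :: "('f, 'p, 'g) lang \<Rightarrow> ('g, 's) ssym \<Rightarrow> nat" where
  "space_ar L (Cont c) = fst c"
| "space_ar L (Further g) = snd (further_ar L g)"

datatype ('f, 'g, 's) stm = SVar nat | SFn "('g, 's) ssym" "'f tm list" "('f, 'g, 's) stm list"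

text \<open>\<open>RRel n \<phi>\<close> is the relation symbol for the formula \<open>\<phi>\<close> of the home language, its tuple of
  variables being the first \<open>n\<close> variables.\<close>

datatype ('f, 'p, 'g, 's) lfm =
    HEq "'f tm" "'f tm"
  | HRel 'p "'f tm list"
  | RRel nat "('f, 'p) fm" "'f tm list"
  | SEq "('f, 'g, 's) stm" "('f, 'g, 's) stm"
  | SRel "'s comp_sym" "('f, 'g, 's) stm list"
  | LNeg "('f, 'p, 'g, 's) lfm"
  | LConj "('f, 'p, 'g, 's) lfm" "('f, 'p, 'g, 's) lfm"
  | LDisj "('f, 'p, 'g, 's) lfm" "('f, 'p, 'g, 's) lfm"
  | HForall nat "('f, 'p, 'g, 's) lfm"
  | HExists nat "('f, 'p, 'g, 's) lfm"
  | SForall nat "('f, 'p, 'g, 's) lfm"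
  | SExists nat "('f, 'p, 'g, 's) lfm"

fun wf_stm :: "'s topology \<Rightarrow> ('f, 'p, 'g) lang \<Rightarrow> ('f, 'g, 's) stm \<Rightarrow> bool" where
  "wf_stm S L (SVar y) \<longleftrightarrow> True"
| "wf_stm S L (SFn f ts ss) \<longleftrightarrow> f \<in> ssyms S L
     \<and> length ts = home_ar L f \<and> (\<forall>t\<in>set ts. wf_tm (home_lang L) t)
     \<and> length ss = space_ar L f \<and> (\<forall>s\<in>set ss. wf_stm S L s)"

fun wf_lfm :: "'s topology \<Rightarrow> ('f, 'p, 'g) lang \<Rightarrow> ('f, 'p, 'g, 's) lfm \<Rightarrow> bool" where
  "wf_lfm S L (HEq s t) \<longleftrightarrow> wf_tm (home_lang L) s \<and> wf_tm (home_lang L) t"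
| "wf_lfm S L (HRel p ts) \<longleftrightarrow> p \<in> rels (home_lang L) \<and> length ts = rel_ar (home_lang L) p
     \<and> (\<forall>t\<in>set ts. wf_tm (home_lang L) t)"
| "wf_lfm S L (RRel n \<phi> ts) \<longleftrightarrow> wf_fm (home_lang L) \<phi> \<and> fv_fm \<phi> \<subseteq> {..<n} \<and> length ts = n
     \<and> (\<forall>t\<in>set ts. wf_tm (home_lang L) t)"
| "wf_lfm S L (SEq s t) \<longleftrightarrow> wf_stm S L s \<and> wf_stm S L t"
| "wf_lfm S L (SRel C ss) \<longleftrightarrow> C \<in> rels (space_lang S) \<and> length ss = fst C
     \<and> (\<forall>s\<in>set ss. wf_stm S L s)"
| "wf_lfm S L (LNeg \<phi>) \<longleftrightarrow> wf_lfm S L \<phi>"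
| "wf_lfm S L (LConj \<phi> \<psi>) \<longleftrightarrow> wf_lfm S L \<phi> \<and> wf_lfm S L \<psi>"
| "wf_lfm S L (LDisj \<phi> \<psi>) \<longleftrightarrow> wf_lfm S L \<phi> \<and> wf_lfm S L \<psi>"
| "wf_lfm S L (HForall x \<phi>) \<longleftrightarrow> wf_lfm S L \<phi>"
| "wf_lfm S L (HExists x \<phi>) \<longleftrightarrow> wf_lfm S L \<phi>"
| "wf_lfm S L (SForall y \<phi>) \<longleftrightarrow> wf_lfm S L \<phi>"
| "wf_lfm S L (SExists y \<phi>) \<longleftrightarrow> wf_lfm S L \<phi>"

fun hfv_stm :: "('f, 'g, 's) stm \<Rightarrow> nat set" where
  "hfv_stm (SVar y) = {}"
| "hfv_stm (SFn f ts ss) = (\<Union>t\<in>set ts. fv_tm t) \<union> (\<Union>s\<in>set ss. hfv_stm s)"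

fun sfv_stm :: "('f, 'g, 's) stm \<Rightarrow> nat set" where
  "sfv_stm (SVar y) = {y}"
| "sfv_stm (SFn f ts ss) = (\<Union>s\<in>set ss. sfv_stm s)"

fun hfv :: "('f, 'p, 'g, 's) lfm \<Rightarrow> nat set" where
  "hfv (HEq s t) = fv_tm s \<union> fv_tm t"
| "hfv (HRel p ts) = (\<Union>t\<in>set ts. fv_tm t)"
| "hfv (RRel n \<phi> ts) = (\<Union>t\<in>set ts. fv_tm t)"
| "hfv (SEq s t) = hfv_stm s \<union> hfv_stm t"
| "hfv (SRel C ss) = (\<Union>s\<in>set ss. hfv_stm s)"
| "hfv (LNeg \<phi>) = hfv \<phi>"
| "hfv (LConj \<phi> \<psi>) = hfv \<phi> \<union> hfv \<psi>"
| "hfv (LDisj \<phi> \<psi>) = hfv \<phi> \<union> hfv \<psi>"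
| "hfv (HForall x \<phi>) = hfv \<phi> - {x}"
| "hfv (HExists x \<phi>) = hfv \<phi> - {x}"
| "hfv (SForall y \<phi>) = hfv \<phi>"
| "hfv (SExists y \<phi>) = hfv \<phi>"

fun sfv :: "('f, 'p, 'g, 's) lfm \<Rightarrow> nat set" where
  "sfv (HEq s t) = {}"
| "sfv (HRel p ts) = {}"
| "sfv (RRel n \<phi> ts) = {}"
| "sfv (SEq s t) = sfv_stm s \<union> sfv_stm t"
| "sfv (SRel C ss) = (\<Union>s\<in>set ss. sfv_stm s)"
| "sfv (LNeg \<phi>) = sfv \<phi>"
| "sfv (LConj \<phi> \<psi>) = sfv \<phi> \<union> sfv \<psi>"
| "sfv (LDisj \<phi> \<psi>) = sfv \<phi> \<union> sfv \<psi>"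
| "sfv (HForall x \<phi>) = sfv \<phi>"
| "sfv (HExists x \<phi>) = sfv \<phi>"
| "sfv (SForall y \<phi>) = sfv \<phi> - {y}"
| "sfv (SExists y \<phi>) = sfv \<phi> - {y}"

definition lsentence :: "'s topology \<Rightarrow> ('f, 'p, 'g) lang \<Rightarrow> ('f, 'p, 'g, 's) lfm \<Rightarrow> bool" where
  "lsentence S L \<phi> \<longleftrightarrow> wf_lfm S L \<phi> \<and> hfv \<phi> = {} \<and> sfv \<phi> = {}"

fun positive_lfm :: "('f, 'p, 'g, 's) lfm \<Rightarrow> bool" where
  "positive_lfm (LNeg \<phi>) \<longleftrightarrow> False"
| "positive_lfm (LConj \<phi> \<psi>) \<longleftrightarrow> positive_lfm \<phi> \<and> positive_lfm \<psi>"
| "positive_lfm (LDisj \<phi> \<psi>) \<longleftrightarrow> positive_lfm \<phi> \<and> positive_lfm \<psi>"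
| "positive_lfm (HForall x \<phi>) \<longleftrightarrow> positive_lfm \<phi>"
| "positive_lfm (HExists x \<phi>) \<longleftrightarrow> positive_lfm \<phi>"
| "positive_lfm (SForall y \<phi>) \<longleftrightarrow> positive_lfm \<phi>"
| "positive_lfm (SExists y \<phi>) \<longleftrightarrow> positive_lfm \<phi>"
| "positive_lfm _ \<longleftrightarrow> True"


section \<open>Two-sorted structures\<close>

record ('f, 'p, 'g, 's, 'h, 'e) lstruct =
  home :: "('f, 'p, 'h) fo_struct"
  space_sort :: "('s cont_sym, 's comp_sym, 'e) fo_struct"
  r_int :: "nat \<Rightarrow> ('f, 'p) fm \<Rightarrow> 'h list \<Rightarrow> bool"
  further_int :: "'g \<Rightarrow> 'h list \<Rightarrow> 'e list \<Rightarrow> 'e"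

fun ssym_int ::
  "('f, 'p, 'g, 's, 'h, 'e) lstruct \<Rightarrow> ('g, 's) ssym \<Rightarrow> 'h list \<Rightarrow> 'e list \<Rightarrow> 'e" where
  "ssym_int M (Cont c) as es = fun_int (space_sort M) c es"
| "ssym_int M (Further g) as es = further_int M g as es"

fun stm_val ::
  "('f, 'p, 'g, 's, 'h, 'e) lstruct \<Rightarrow> (nat \<Rightarrow> 'h) \<Rightarrow> (nat \<Rightarrow> 'e) \<Rightarrow> ('f, 'g, 's) stm \<Rightarrow> 'e" where
  "stm_val M v w (SVar y) = w y"
| "stm_val M v w (SFn f ts ss) = ssym_int M f (map (tm_val (home M) v) ts) (map (stm_val M v w) ss)"

fun lfm_sat ::
  "('f, 'p, 'g, 's, 'h, 'e) lstruct \<Rightarrow> (nat \<Rightarrow> 'h) \<Rightarrow> (nat \<Rightarrow> 'e) \<Rightarrow> ('f, 'p, 'g, 's) lfm \<Rightarrow> bool"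
where
  "lfm_sat M v w (HEq s t) \<longleftrightarrow> tm_val (home M) v s = tm_val (home M) v t"
| "lfm_sat M v w (HRel p ts) \<longleftrightarrow> rel_int (home M) p (map (tm_val (home M) v) ts)"
| "lfm_sat M v w (RRel n \<phi> ts) \<longleftrightarrow> r_int M n \<phi> (map (tm_val (home M) v) ts)"
| "lfm_sat M v w (SEq s t) \<longleftrightarrow> stm_val M v w s = stm_val M v w t"
| "lfm_sat M v w (SRel C ss) \<longleftrightarrow> rel_int (space_sort M) C (map (stm_val M v w) ss)"
| "lfm_sat M v w (LNeg \<phi>) \<longleftrightarrow> \<not> lfm_sat M v w \<phi>"
| "lfm_sat M v w (LConj \<phi> \<psi>) \<longleftrightarrow> lfm_sat M v w \<phi> \<and> lfm_sat M v w \<psi>"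
| "lfm_sat M v w (LDisj \<phi> \<psi>) \<longleftrightarrow> lfm_sat M v w \<phi> \<or> lfm_sat M v w \<psi>"
| "lfm_sat M v w (HForall x \<phi>) \<longleftrightarrow> (\<forall>a\<in>univ (home M). lfm_sat M (v(x := a)) w \<phi>)"
| "lfm_sat M v w (HExists x \<phi>) \<longleftrightarrow> (\<exists>a\<in>univ (home M). lfm_sat M (v(x := a)) w \<phi>)"
| "lfm_sat M v w (SForall y \<phi>) \<longleftrightarrow> (\<forall>e\<in>univ (space_sort M). lfm_sat M v (w(y := e)) \<phi>)"
| "lfm_sat M v w (SExists y \<phi>) \<longleftrightarrow> (\<exists>e\<in>univ (space_sort M). lfm_sat M v (w(y := e)) \<phi>)"

definition lmodels ::
  "('f, 'p, 'g, 's, 'h, 'e) lstruct \<Rightarrow> ('f, 'p, 'g, 's) lfm set \<Rightarrow> bool" where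
  "lmodels M T \<longleftrightarrow> (\<forall>\<phi>\<in>T. \<forall>v w. range v \<subseteq> univ (home M) \<and> range w \<subseteq> univ (space_sort M)
     \<longrightarrow> lfm_sat M v w \<phi>)"

definition two_sorted_structure ::
  "'s topology \<Rightarrow> ('f, 'p, 'g) lang \<Rightarrow> ('f, 'p, 'g, 's, 'h, 'e) lstruct \<Rightarrow> bool" where
  "two_sorted_structure S L M \<longleftrightarrow>
     fo_structure (home_lang L) (home M) \<and> fo_structure (space_lang S) (space_sort M) \<and>
     (\<forall>g\<in>further L. \<forall>as es. length as = fst (further_ar L g) \<and> set as \<subseteq> univ (home M) \<and>
        length es = snd (further_ar L g) \<and> set es \<subseteq> univ (space_sort M)
        \<longrightarrow> further_int M g as es \<in> univ (space_sort M))"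

text \<open>\<open>equicont_at S L M f \<epsilon> \<delta>\<close> is the equicontinuity condition on \<open>f\<close> for the given \<open>\<epsilon>\<close> and
  \<open>\<delta>\<close>. It is void for a symbol without arguments in the sort of the space: there \<open>\<delta>\<close> could only
  be the one-point space (and would be a relation symbol of arity 0), and what remains is that
  \<open>f(x)\<close> be \<open>\<epsilon>\<close>-close to itself.\<close>

definition equicont_at ::
  "'s topology \<Rightarrow> ('f, 'p, 'g) lang \<Rightarrow> ('f, 'p, 'g, 's, 'h, 'e) lstruct \<Rightarrow> ('g, 's) ssym \<Rightarrow>
   (nat \<Rightarrow> 's) set \<Rightarrow> (nat \<Rightarrow> 's) set \<Rightarrow> bool" where
  "equicont_at S L M f \<epsilon> \<delta> \<longleftrightarrow> (let n = home_ar L f; m = space_ar L f in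
     0 < m \<longrightarrow> compact_diag_nbhd S m \<delta> \<and>
     (\<forall>as es es'. length as = n \<and> set as \<subseteq> univ (home M) \<and>
        length es = m \<and> set es \<subseteq> univ (space_sort M) \<and>
        length es' = m \<and> set es' \<subseteq> univ (space_sort M) \<and>
        rel_int (space_sort M) (2 * m, \<delta>) (es @ es')
        \<longrightarrow> rel_int (space_sort M) (2, \<epsilon>) [ssym_int M f as es, ssym_int M f as es']))"

definition equicontinuous ::
  "'s topology \<Rightarrow> ('f, 'p, 'g) lang \<Rightarrow> ('f, 'p, 'g, 's, 'h, 'e) lstruct \<Rightarrow> bool" where
  "equicontinuous S L M \<longleftrightarrow>
     (\<forall>f\<in>ssyms S L. \<forall>\<epsilon>. compact_diag_nbhd S 1 \<epsilon> \<longrightarrow> (\<exists>\<delta>. equicont_at S L M f \<epsilon> \<delta>))"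

text \<open>A modulus picks \<open>\<delta>\<close> for every \<open>\<epsilon>\<close> and every symbol \<open>f\<close>; it cannot depend on \<open>\<epsilon>\<close> alone,
  since \<open>\<delta>\<close> lives in a power of the space given by the arity of \<open>f\<close>.\<close>

definition modulus ::
  "'s topology \<Rightarrow> ('f, 'p, 'g) lang \<Rightarrow> ('f, 'p, 'g, 's, 'h, 'e) lstruct \<Rightarrow>
   (('g, 's) ssym \<Rightarrow> (nat \<Rightarrow> 's) set \<Rightarrow> (nat \<Rightarrow> 's) set) \<Rightarrow> bool" where
  "modulus S L M \<Delta> \<longleftrightarrow>
     (\<forall>f\<in>ssyms S L. \<forall>\<epsilon>. compact_diag_nbhd S 1 \<epsilon> \<longrightarrow> equicont_at S L M f \<epsilon> (\<Delta> f \<epsilon>))"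

text \<open>The sort of the space is interpreted by an elementary extension of the space, up to
  isomorphism: as every point is named by a constant, this is the clause \<open>elem_equiv\<close>. Without it a
  structure could satisfy a positive sentence such as \<open>c \<in> {d}\<close> for distinct points \<open>c\<close> and \<open>d\<close>,
  which has no standard model.\<close>

definition lstructure ::
  "'s topology \<Rightarrow> ('f, 'p, 'g) lang \<Rightarrow> ('f, 'p, 'g, 's, 'h, 'e) lstruct \<Rightarrow> bool" where
  "lstructure S L M \<longleftrightarrow>
     two_sorted_structure S L M \<and>
     elem_equiv (space_lang S) (space_struct S) (space_sort M) \<and>
     (\<forall>n \<phi>. wf_fm (home_lang L) \<phi> \<and> fv_fm \<phi> \<subseteq> {..<n} \<longrightarrow>
        (\<forall>v. range v \<subseteq> univ (home M) \<longrightarrow> (r_int M n \<phi> (map v [0..<n]) \<longleftrightarrow> fm_sat (home M) v \<phi>))) \<and>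
     equicontinuous S L M"

definition standard_structure ::
  "'s topology \<Rightarrow> ('f, 'p, 'g) lang \<Rightarrow> ('f, 'p, 'g, 's, 'h, 's) lstruct \<Rightarrow> bool" where
  "standard_structure S L M \<longleftrightarrow> lstructure S L M \<and> space_sort M = space_struct S"

text \<open>The type arguments are the types in which the universes of the structures are taken.\<close>

definition unif_fin_consistent ::
  "'h itself \<Rightarrow> 'e itself \<Rightarrow> 's topology \<Rightarrow> ('f, 'p, 'g) lang \<Rightarrow> ('f, 'p, 'g, 's) lfm set \<Rightarrow> bool" where
  "unif_fin_consistent _ _ S L T \<longleftrightarrow>
     (\<exists>\<Delta>. \<forall>T0. finite T0 \<and> T0 \<subseteq> T \<longrightarrow>
        (\<exists>M :: ('f, 'p, 'g, 's, 'h, 'e) lstruct. lstructure S L M \<and> modulus S L M \<Delta> \<and> lmodels M T0))"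

definition standardly_consistent ::
  "'h itself \<Rightarrow> 's topology \<Rightarrow> ('f, 'p, 'g) lang \<Rightarrow> ('f, 'p, 'g, 's) lfm set \<Rightarrow> bool" where
  "standardly_consistent _ S L T \<longleftrightarrow>
     (\<exists>M :: ('f, 'p, 'g, 's, 'h, 's) lstruct. standard_structure S L M \<and> lmodels M T)"

end

theory Submission
  imports Defs
begin

text \<open>The witnesses for the finite subsets of \<open>T\<close> are amalgamated along an ultrafilter \<open>U\<close>. The home
  sort of the standard model is the ultraproduct of their home sorts. A family of points of the
  space sorts has a standard part, the unique point of \<open>S\<close> lying in every compact set to which the
  family belongs along \<open>U\<close>; a further symbol is interpreted at points of \<open>S\<close> as the standard part
  of its values at the corresponding constants. The common modulus makes the value of every symbol
  depend, up to standard part, only on the standard parts of its arguments, so terms commute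
  with standard parts. As compact sets are closed, satisfaction of positive formulas passes
  from the family to the standard parts.\<close>

section \<open>Ultrafilters and ultraproducts\<close>

text \<open>Satisfaction survives the passage to standard parts in one direction only: a family may
  stay outside a compact set along \<open>U\<close> while its standard part lies in it. Formulas are
  therefore pushed from the family to the limit and not pulled back, which is where positivity
  enters. The home sort, an ordinary ultraproduct, keeps full first-order truth, including negations
  inside formulas named by an \<open>RRel\<close> symbol. In the space sorts, logic replaces
  topology: compact subsets of the powers of \<open>S\<close> are relation symbols, so elementary
  equivalence carries inclusions between compact sets, and the values of continuous maps at
  constants, over to each member of the family. The modulus has to be common because closeness along
  \<open>U\<close> is available only for a fixed compact neighbourhood: if \<delta> varied with the
  index, arguments with equal standard parts need not be \<delta>-close along \<open>U\<close>.
  Indices are sets of formulas, and a finite subset of \<open>T\<close> indexes a model of itself;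
  hence the function type of the home universe in the conclusion.\<close>

definition ultrafilter :: "'i filter \<Rightarrow> bool" where
  "ultrafilter U \<longleftrightarrow> U \<noteq> bot \<and> (\<forall>P. eventually P U \<or> eventually (\<lambda>i. \<not> P i) U)"

lemma ultrafilter_not_iff:
  assumes "ultrafilter U"
  shows "eventually (\<lambda>i. \<not> P i) U \<longleftrightarrow> \<not> eventually P U"
proof
  assume 1: "eventually (\<lambda>i. \<not> P i) U"
  show "\<not> eventually P U"
  proof
    assume "eventually P U"
    with 1 have "eventually (\<lambda>i. False) U" by eventually_elim simp
    then show False using assms by (simp add: ultrafilter_def eventually_False)
  qed
qed (use assms in \<open>auto simp: ultrafilter_def\<close>)

lemma ultrafilter_disj_iff:
  assumes "ultrafilter U"
  shows "eventually (\<lambda>i. P i \<or> Q i) U \<longleftrightarrow> eventually P U \<or> eventually Q U"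
proof
  assume 1: "eventually (\<lambda>i. P i \<or> Q i) U"
  show "eventually P U \<or> eventually Q U"
  proof (rule ccontr)
    assume "\<not> (eventually P U \<or> eventually Q U)"
    then have "eventually (\<lambda>i. \<not> P i) U" "eventually (\<lambda>i. \<not> Q i) U"
      using ultrafilter_not_iff[OF assms] by auto
    with 1 have "eventually (\<lambda>i. False) U" by eventually_elim simp
    then show False using assms by (simp add: ultrafilter_def eventually_False)
  qed
qed (auto elim: eventually_mono)

text \<open>Zorn's lemma for the reversed order gives a minimal proper filter below
  \<open>F\<close>. The infimum of a nonempty chain is proper because an event of the infimum is
  already an event of some member. Minimality makes the filter decide every \<open>P\<close>: unless
  it contains the negation of \<open>P\<close>, adding \<open>P\<close> keeps it proper and so
  changes nothing.\<close>

lemma ultrafilter_below: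
  assumes "F \<noteq> bot"
  obtains U where "ultrafilter U" "U \<le> F"
proof -
  let ?A = "{G. G \<noteq> bot \<and> G \<le> F}"
  have po: "partial_order_on ?A (relation_of (\<ge>) ?A)"
    by (rule partial_order_on_relation_ofI) auto
  have "\<exists>m\<in>?A. \<forall>a\<in>?A. m \<ge> a \<longrightarrow> a = m"
  proof (rule predicate_Zorn[OF po])
    fix C assume C: "C \<in> Chains (relation_of (\<ge>) ?A)"
    then have CA: "C \<subseteq> ?A" and ch: "\<And>a b. a \<in> C \<Longrightarrow> b \<in> C \<Longrightarrow> a \<le> b \<or> b \<le> a"
      by (auto simp: Chains_def relation_of_def)
    show "\<exists>u\<in>?A. \<forall>a\<in>C. a \<ge> u"
    proof (cases "C = {}")
      case True
      then show ?thesis using assms by auto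
    next
      case False
      have "eventually (\<lambda>_. False) (Inf C) \<longleftrightarrow> (\<exists>b\<in>C. eventually (\<lambda>_. False) b)"
        by (rule eventually_Inf_base[OF False]) (metis ch inf.absorb1 inf.absorb2)
      moreover have "\<not> (\<exists>b\<in>C. eventually (\<lambda>_. False) b)"
        using CA by (auto simp: eventually_False)
      ultimately have "Inf C \<noteq> bot" by (auto simp: eventually_False)
      moreover obtain c where "c \<in> C" using False by blast
      then have "Inf C \<le> F" using CA by (intro Inf_lower2[of c]) auto
      ultimately show ?thesis by (auto intro: Inf_lower)
    qed
  qed
  then obtain U where U: "U \<noteq> bot" "U \<le> F"
    and min: "\<And>G. G \<noteq> bot \<Longrightarrow> G \<le> F \<Longrightarrow> G \<le> U \<Longrightarrow> G = U" by blast
  have "eventually P U \<or> eventually (\<lambda>i. \<not> P i) U" for P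
  proof (rule disjCI)
    assume "\<not> eventually (\<lambda>i. \<not> P i) U"
    then have "inf U (principal {i. P i}) \<noteq> bot"
      by (auto simp: trivial_limit_def eventually_inf_principal)
    then have "inf U (principal {i. P i}) = U"
      by (rule min) (use U in \<open>auto intro: le_infI1\<close>)
    moreover have "eventually P (inf U (principal {i. P i}))"
      by (simp add: eventually_inf_principal)
    ultimately show "eventually P U" by simp
  qed
  with U show ?thesis by (intro that[of U]) (auto simp: ultrafilter_def)
qed

text \<open>The ultraproduct is realised on canonical representatives instead of equivalence classes, so
  that its elements are again families.\<close>

definition uprod_rep :: "'i filter \<Rightarrow> ('i \<Rightarrow> ('f, 'p, 'a) fo_struct) \<Rightarrow> ('i \<Rightarrow> 'a) \<Rightarrow> 'i \<Rightarrow> 'a" where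
  "uprod_rep U A x = (SOME y. (\<forall>i. y i \<in> univ (A i)) \<and> eventually (\<lambda>i. x i = y i) U)"

definition ultraproduct ::
  "'i filter \<Rightarrow> ('i \<Rightarrow> ('f, 'p, 'a) fo_struct) \<Rightarrow> ('f, 'p, 'i \<Rightarrow> 'a) fo_struct" where
  "ultraproduct U A = \<lparr>
     univ = uprod_rep U A ` {x. \<forall>i. x i \<in> univ (A i)},
     fun_int = (\<lambda>f as. uprod_rep U A (\<lambda>i. fun_int (A i) f (map (\<lambda>a. a i) as))),
     rel_int = (\<lambda>p as. eventually (\<lambda>i. rel_int (A i) p (map (\<lambda>a. a i) as)) U)\<rparr>"

lemma uprod_rep:
  assumes "\<And>i. x i \<in> univ (A i)"
  shows "uprod_rep U A x i \<in> univ (A i)" "eventually (\<lambda>i. x i = uprod_rep U A x i) U"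
    "uprod_rep U A x \<in> univ (ultraproduct U A)"
proof -
  have "\<exists>y. (\<forall>i. y i \<in> univ (A i)) \<and> eventually (\<lambda>i. x i = y i) U"
    using assms by (intro exI[of _ x]) auto
  from someI_ex[OF this] show "uprod_rep U A x i \<in> univ (A i)"
    "eventually (\<lambda>i. x i = uprod_rep U A x i) U"
    by (auto simp: uprod_rep_def)
  show "uprod_rep U A x \<in> univ (ultraproduct U A)"
    using assms by (auto simp: ultraproduct_def)
qed

lemma uprod_rep_cong:
  assumes "eventually (\<lambda>i. x i = y i) U"
  shows "uprod_rep U A x = uprod_rep U A y"
proof -
  have "eventually (\<lambda>i. x i = z i) U \<longleftrightarrow> eventually (\<lambda>i. y i = z i) U" for z
    using assms by (intro eventually_cong) (auto elim: eventually_mono)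
  then show ?thesis by (simp add: uprod_rep_def)
qed

lemma ultraproduct_univ_component:
  "a \<in> univ (ultraproduct U A) \<Longrightarrow> a i \<in> univ (A i)"
  by (auto simp: ultraproduct_def uprod_rep)

lemma ultraproduct_eq_iff:
  assumes "a \<in> univ (ultraproduct U A)" "b \<in> univ (ultraproduct U A)"
  shows "a = b \<longleftrightarrow> eventually (\<lambda>i. a i = b i) U"
proof
  assume ev: "eventually (\<lambda>i. a i = b i) U"
  have idem: "uprod_rep U A c = c" if "c \<in> univ (ultraproduct U A)" for c
  proof -
    from that obtain x where x: "c = uprod_rep U A x" "\<And>i. x i \<in> univ (A i)"
      by (auto simp: ultraproduct_def)
    with uprod_rep(2)[of x A U] show ?thesis
      using uprod_rep_cong[of x c U A] by simp
  qed
  show "a = b" using uprod_rep_cong[OF ev, of A] idem assms by simp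
qed auto

lemma fo_structure_ex: "fo_structure L A \<Longrightarrow> \<exists>a. a \<in> univ A"
  by (auto simp: fo_structure_def)

lemma fo_structure_fun_int:
  "fo_structure L A \<Longrightarrow> f \<in> funs L \<Longrightarrow> length as = fun_ar L f \<Longrightarrow> set as \<subseteq> univ A \<Longrightarrow>
    fun_int A f as \<in> univ A"
  by (simp add: fo_structure_def)

lemma tm_val_in_univ:
  assumes "fo_structure L A" "range v \<subseteq> univ A" "wf_tm L t"
  shows "tm_val A v t \<in> univ A"
  using assms(3)
proof (induction t)
  case (Var x)
  then show ?case using assms(2) by auto
next
  case (Fn f ts)
  then show ?case by (auto intro!: fo_structure_fun_int[OF assms(1)])
qed

lemma fo_structure_ultraproduct:
  assumes "\<And>i. fo_structure L (A i)"
  shows "fo_structure L (ultraproduct U A)"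
proof -
  have "\<forall>i. \<exists>a. a \<in> univ (A i)" using fo_structure_ex[OF assms] by blast
  then obtain a where "\<And>i. a i \<in> univ (A i)" by metis
  then have "univ (ultraproduct U A) \<noteq> {}" using uprod_rep(3) by blast
  moreover have "fun_int (ultraproduct U A) f as \<in> univ (ultraproduct U A)"
    if "f \<in> funs L" "length as = fun_ar L f" "set as \<subseteq> univ (ultraproduct U A)" for f as
  proof -
    have "fun_int (A i) f (map (\<lambda>a. a i) as) \<in> univ (A i)" for i
      using that ultraproduct_univ_component[of _ U A i]
      by (force intro!: fo_structure_fun_int[OF assms])
    from uprod_rep(3)[OF this, of U] show ?thesis by (simp add: ultraproduct_def)
  qed
  ultimately show ?thesis by (auto simp: fo_structure_def)
qed

lemma eventually_map_eq:
  assumes "\<And>t. t \<in> set ts \<Longrightarrow> eventually (\<lambda>i. f t i = g i t) U"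
  shows "eventually (\<lambda>i. map (\<lambda>t. f t i) ts = map (g i) ts) U"
proof -
  have "eventually (\<lambda>i. \<forall>t\<in>set ts. f t i = g i t) U"
    using assms by (intro eventually_ball_finite) auto
  then show ?thesis by eventually_elim simp
qed

text \<open>Equality holds only along \<open>U\<close>, because applying a symbol in the
  ultraproduct replaces the componentwise value by a representative that agrees with it only along
  \<open>U\<close>. A term has finitely many symbols, so the exceptions stay negligible.\<close>

lemma ultraproduct_tm_val:
  assumes str: "\<And>i. fo_structure L (A i)" and v: "range v \<subseteq> univ (ultraproduct U A)"
    and "wf_tm L t"
  shows "eventually (\<lambda>i. tm_val (ultraproduct U A) v t i = tm_val (A i) (\<lambda>x. v x i) t) U"
  using assms(3)
proof (induction t)
  case (Var x)
  show ?case by simp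
next
  case (Fn f ts)
  let ?N = "ultraproduct U A"
  let ?y = "\<lambda>i. fun_int (A i) f (map (\<lambda>t. tm_val ?N v t i) ts)"
  have N: "tm_val ?N v (Fn f ts) = uprod_rep U A ?y"
    by (simp add: ultraproduct_def comp_def)
  have "?y i \<in> univ (A i)" for i
    using Fn.prems tm_val_in_univ[OF fo_structure_ultraproduct[where A = A, OF str] v]
      ultraproduct_univ_component[of _ U A i]
    by (auto intro!: fo_structure_fun_int[OF str])
  from uprod_rep(2)[OF this]
  have 1: "eventually (\<lambda>i. ?y i = tm_val ?N v (Fn f ts) i) U" unfolding N .
  have "eventually (\<lambda>i. map (\<lambda>t. tm_val ?N v t i) ts = map (tm_val (A i) (\<lambda>x. v x i)) ts) U"
    by (rule eventually_map_eq) (use Fn in auto)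
  with 1 show ?case by eventually_elim simp
qed

lemma Los_theorem:
  assumes U: "ultrafilter U" and str: "\<And>i. fo_structure L (A i)"
    and "range v \<subseteq> univ (ultraproduct U A)" "wf_fm L \<phi>"
  shows "fm_sat (ultraproduct U A) v \<phi> \<longleftrightarrow> eventually (\<lambda>i. fm_sat (A i) (\<lambda>x. v x i) \<phi>) U"
  using assms(3,4)
proof (induction \<phi> arbitrary: v)
  case (Eq s t)
  let ?N = "ultraproduct U A"
  have st: "eventually (\<lambda>i. tm_val ?N v s i = tm_val (A i) (\<lambda>x. v x i) s) U"
    "eventually (\<lambda>i. tm_val ?N v t i = tm_val (A i) (\<lambda>x. v x i) t) U"
    using Eq by (auto intro!: ultraproduct_tm_val str)
  have "tm_val ?N v s = tm_val ?N v t \<longleftrightarrow> eventually (\<lambda>i. tm_val ?N v s i = tm_val ?N v t i) U"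
    using tm_val_in_univ[OF fo_structure_ultraproduct[where A = A, OF str]] Eq by (intro ultraproduct_eq_iff) auto
  also have "\<dots> \<longleftrightarrow> eventually (\<lambda>i. tm_val (A i) (\<lambda>x. v x i) s = tm_val (A i) (\<lambda>x. v x i) t) U"
    by (rule eventually_cong[OF eventually_conj[OF st]]) auto
  finally show ?case by simp
next
  case (Rel p ts)
  let ?N = "ultraproduct U A"
  have "eventually (\<lambda>i. map (\<lambda>t. tm_val ?N v t i) ts = map (tm_val (A i) (\<lambda>x. v x i)) ts) U"
    by (rule eventually_map_eq, rule ultraproduct_tm_val[where L = L]) (use str Rel in auto)
  then have "eventually (\<lambda>i. rel_int (A i) p (map (\<lambda>t. tm_val ?N v t i) ts)) U \<longleftrightarrow>
    eventually (\<lambda>i. rel_int (A i) p (map (tm_val (A i) (\<lambda>x. v x i)) ts)) U"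
    by (rule eventually_cong) (simp cong: map_cong)
  then show ?case by (simp add: ultraproduct_def comp_def)
next
  case (Neg \<phi>)
  then show ?case by (simp add: ultrafilter_not_iff[OF U])
next
  case (Conj \<phi> \<psi>)
  then show ?case by (simp add: eventually_conj_iff)
next
  case (Disj \<phi> \<psi>)
  then show ?case by (simp add: ultrafilter_disj_iff[OF U])
next
  case (Exists x \<phi>)
  show ?case
  proof
    assume "fm_sat (ultraproduct U A) v (Exists x \<phi>)"
    then obtain a where a: "a \<in> univ (ultraproduct U A)"
      "fm_sat (ultraproduct U A) (v(x := a)) \<phi>" by auto
    then have "eventually (\<lambda>i. fm_sat (A i) (\<lambda>y. (v(x := a)) y i) \<phi>) U"
      using Exists by (subst Exists.IH[symmetric]) auto
    moreover have "(\<lambda>y. (v(x := a)) y i) = (\<lambda>y. v y i)(x := a i)" for i by auto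
    ultimately show "eventually (\<lambda>i. fm_sat (A i) (\<lambda>y. v y i) (Exists x \<phi>)) U"
      using ultraproduct_univ_component[OF a(1)] by (auto elim!: eventually_mono)
  next
    assume ev: "eventually (\<lambda>i. fm_sat (A i) (\<lambda>y. v y i) (Exists x \<phi>)) U"
    \<comment> \<open>An arbitrary element serves where no witness exists, so that \<open>a\<close>
      is defined at every index.\<close>
    have "\<exists>a\<in>univ (A i). fm_sat (A i) (\<lambda>y. v y i) (Exists x \<phi>) \<longrightarrow>
      fm_sat (A i) ((\<lambda>y. v y i)(x := a)) \<phi>" for i
      using fo_structure_ex[OF str[of i]] by auto
    then obtain a where a: "\<And>i. a i \<in> univ (A i)" "\<And>i. fm_sat (A i) (\<lambda>y. v y i) (Exists x \<phi>) \<Longrightarrow>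
      fm_sat (A i) ((\<lambda>y. v y i)(x := a i)) \<phi>" by metis
    let ?b = "uprod_rep U A a"
    have "(\<lambda>y. (v(x := ?b)) y i) = (\<lambda>y. v y i)(x := ?b i)" for i by auto
    moreover have "eventually (\<lambda>i. fm_sat (A i) ((\<lambda>y. v y i)(x := ?b i)) \<phi>) U"
      using ev uprod_rep(2)[of a A U, OF a(1)] by eventually_elim (use a(2) in force)
    ultimately have "eventually (\<lambda>i. fm_sat (A i) (\<lambda>y. (v(x := ?b)) y i) \<phi>) U" by simp
    then have "fm_sat (ultraproduct U A) (v(x := ?b)) \<phi>"
      using Exists.prems uprod_rep(3)[of a A, OF a(1)] by (subst Exists.IH) auto
    then show "fm_sat (ultraproduct U A) v (Exists x \<phi>)"
      using uprod_rep(3)[of a A, OF a(1)] by auto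
  qed
next
  case (Forall x \<phi>)
  show ?case
  proof
    assume all: "fm_sat (ultraproduct U A) v (Forall x \<phi>)"
    \<comment> \<open>Each component chooses a counterexample if it has one. If
      \<open>\<phi>\<close> holds along \<open>U\<close> even at this family, then there is no
      counterexample along \<open>U\<close>.\<close>
    have "\<exists>a\<in>univ (A i). fm_sat (A i) ((\<lambda>y. v y i)(x := a)) \<phi> \<longrightarrow>
      fm_sat (A i) (\<lambda>y. v y i) (Forall x \<phi>)" for i
      using fo_structure_ex[OF str[of i]] by auto
    then obtain a where a: "\<And>i. a i \<in> univ (A i)" "\<And>i. fm_sat (A i) ((\<lambda>y. v y i)(x := a i)) \<phi> \<Longrightarrow>
      fm_sat (A i) (\<lambda>y. v y i) (Forall x \<phi>)" by metis
    let ?b = "uprod_rep U A a"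
    have "fm_sat (ultraproduct U A) (v(x := ?b)) \<phi>"
      using all uprod_rep(3)[of a A, OF a(1)] by auto
    then have "eventually (\<lambda>i. fm_sat (A i) (\<lambda>y. (v(x := ?b)) y i) \<phi>) U"
      using Forall.prems uprod_rep(3)[of a A, OF a(1)] by (subst Forall.IH[symmetric]) auto
    moreover have "(\<lambda>y. (v(x := ?b)) y i) = (\<lambda>y. v y i)(x := ?b i)" for i by auto
    ultimately have "eventually (\<lambda>i. fm_sat (A i) ((\<lambda>y. v y i)(x := ?b i)) \<phi>) U" by simp
    then show "eventually (\<lambda>i. fm_sat (A i) (\<lambda>y. v y i) (Forall x \<phi>)) U"
      using uprod_rep(2)[of a A, OF a(1)] by eventually_elim (use a(2) in force)
  next
    assume ev: "eventually (\<lambda>i. fm_sat (A i) (\<lambda>y. v y i) (Forall x \<phi>)) U"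
    have "fm_sat (ultraproduct U A) (v(x := a)) \<phi>" if a: "a \<in> univ (ultraproduct U A)" for a
    proof -
      have "(\<lambda>y. (v(x := a)) y i) = (\<lambda>y. v y i)(x := a i)" for i by auto
      then have "eventually (\<lambda>i. fm_sat (A i) (\<lambda>y. (v(x := a)) y i) \<phi>) U"
        using ev ultraproduct_univ_component[OF a] by (auto elim!: eventually_mono)
      then show ?thesis using Forall.prems a by (subst Forall.IH) auto
    qed
    then show "fm_sat (ultraproduct U A) v (Forall x \<phi>)" by simp
  qed
qed

section \<open>Transfer from the space to elementarily equivalent structures\<close>

lemma fo_models_Forall: "fo_models A (Forall x \<phi>) \<longleftrightarrow> fo_models A \<phi>"
proof
  assume "fo_models A (Forall x \<phi>)"
  then have "fm_sat A (v(x := v x)) \<phi>" if "range v \<subseteq> univ A" for v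
    using that unfolding fo_models_def fm_sat.simps by blast
  then show "fo_models A \<phi>" by (simp add: fo_models_def)
next
  assume "fo_models A \<phi>"
  moreover have "range (v(x := a)) \<subseteq> univ A" if "range v \<subseteq> univ A" "a \<in> univ A" for v a
    using that by auto
  ultimately show "fo_models A (Forall x \<phi>)" by (simp add: fo_models_def)
qed

lemma finite_fv_tm: "finite (fv_tm t)"
  by (induction t) auto

lemma finite_fv_fm: "finite (fv_fm \<phi>)"
  by (induction \<phi>) (auto simp: finite_fv_tm)

text \<open>Elementary equivalence speaks of sentences only; validity under all assignments is the
  truth of the universal closure, which is a sentence.\<close>

lemma elem_equiv_fo_models_iff:
  assumes "elem_equiv L A B" "wf_fm L \<phi>"
  shows "fo_models A \<phi> \<longleftrightarrow> fo_models B \<phi>"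
proof -
  obtain xs where xs: "set xs = fv_fm \<phi>" using finite_list[OF finite_fv_fm] by blast
  let ?c = "\<lambda>ys. foldr Forall ys \<phi>"
  have "fo_models C (?c ys) \<longleftrightarrow> fo_models C \<phi>" for C :: "('a, 'b, 'x) fo_struct" and ys
    by (induction ys) (auto simp: fo_models_Forall)
  moreover have "fo_models C (?c ys) \<longleftrightarrow> fo_models C \<phi>" for C :: "('a, 'b, 'd) fo_struct" and ys
    by (induction ys) (auto simp: fo_models_Forall)
  moreover have "wf_fm L (?c ys)" for ys using assms(2) by (induction ys) auto
  moreover have "fv_fm (?c ys) = fv_fm \<phi> - set ys" for ys by (induction ys) auto
  ultimately show ?thesis using assms(1) xs
    unfolding elem_equiv_def by (metis Diff_cancel)
qed

lemma fm_sat_foldr_Disj: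
  "fm_sat A v (foldr Disj \<phi>s \<psi>) \<longleftrightarrow> (\<exists>\<phi>\<in>set \<phi>s. fm_sat A v \<phi>) \<or> fm_sat A v \<psi>"
  by (induction \<phi>s) auto

lemma wf_fm_foldr_Disj:
  "wf_fm L (foldr Disj \<phi>s \<psi>) \<longleftrightarrow> (\<forall>\<phi>\<in>set \<phi>s. wf_fm L \<phi>) \<and> wf_fm L \<psi>"
  by (induction \<phi>s) auto

lemma tuple_in_topspace_iff:
  "tuple xs \<in> topspace (space_pow S (length xs)) \<longleftrightarrow> set xs \<subseteq> topspace S"
  by (auto simp: space_pow_def tuple_def PiE_iff set_conv_nth subset_iff)

lemma pair_in_topspace_iff:
  "tuple [s, t] \<in> topspace (space_pow S 2) \<longleftrightarrow> s \<in> topspace S \<and> t \<in> topspace S"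
  using tuple_in_topspace_iff[of "[s, t]" S] by (simp add: numeral_2_eq_2)

lemma tuple_map_upt:
  assumes "p \<in> extensional {..<n}"
  shows "tuple (map p [0..<n]) = p"
  using assms by (auto simp: tuple_def extensional_def)

lemma tuple_nth: "tuple xs j = xs ! j" if "j < length xs"
  using that by (simp add: tuple_def)

text \<open>A constant is a continuous map on the power with exponent 0, which is a one-point space;
  the restriction provides the extensionality required of function symbols.\<close>

definition const_sym :: "'s topology \<Rightarrow> 's \<Rightarrow> 's cont_sym" where
  "const_sym S s = (0, restrict (\<lambda>_. s) (topspace (space_pow S 0)))"

lemma const_sym_in_funs: "s \<in> topspace S \<Longrightarrow> const_sym S s \<in> funs (space_lang S)"
  by (auto simp: const_sym_def space_lang_def intro: continuous_map_eq[of _ _ "\<lambda>_. s"])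

lemma fun_ar_const_sym: "fun_ar (space_lang S) (const_sym S s) = 0"
  by (simp add: const_sym_def space_lang_def)

lemma fun_int_const_sym: "fun_int (space_struct S) (const_sym S s) [] = s"
  using tuple_in_topspace_iff[of "[]" S] by (simp add: const_sym_def space_struct_def)

lemma compact_space_pow: "compact_space S \<Longrightarrow> compact_space (space_pow S n)"
  by (simp add: space_pow_def compact_space_product_topology)

lemma Hausdorff_space_pow: "Hausdorff_space S \<Longrightarrow> Hausdorff_space (space_pow S n)"
  by (simp add: space_pow_def Hausdorff_space_product_topology)

text \<open>This is what makes complements of open sets, intersections and preimages of closed sets
  available as relation symbols.\<close>

lemma compactin_space_pow_iff:
  assumes "compact_space S" "Hausdorff_space S"
  shows "compactin (space_pow S n) C \<longleftrightarrow> closedin (space_pow S n) C"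
  using closedin_compact_space[OF compact_space_pow[OF assms(1)]]
    compactin_imp_closedin[OF Hausdorff_space_pow[OF assms(2)]] by (intro iffI)

lemma continuous_map_space_pow_component:
  "j < n \<Longrightarrow> continuous_map (space_pow S n) S (\<lambda>p. p j)"
  unfolding space_pow_def by (rule continuous_map_product_projection) simp

lemma closedin_diagonal:
  assumes "Hausdorff_space S"
  shows "closedin (space_pow S 2) (diagonal S 1)"
proof -
  have "closedin (space_pow S 2) {a \<in> topspace (space_pow S 2). a 0 = a 1}"
    using assms by (intro closedin_continuous_maps_eq[of S] continuous_map_space_pow_component) auto
  then show ?thesis by (simp add: diagonal_def)
qed


section \<open>Standard parts\<close>

locale standard_part =
  fixes S :: "'s topology" and L :: "('f, 'p, 'g) lang" and U :: "'i filter"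
    and M :: "'i \<Rightarrow> ('f, 'p, 'g, 's, 'h, 'e) lstruct"
    and \<Delta> :: "('g, 's) ssym \<Rightarrow> (nat \<Rightarrow> 's) set \<Rightarrow> (nat \<Rightarrow> 's) set"
  assumes compact: "compact_space S" and Hausdorff: "Hausdorff_space S"
    and ultra: "ultrafilter U"
    and lstr: "\<And>i. lstructure S L (M i)" and mod: "\<And>i. modulus S L (M i) \<Delta>"
begin

abbreviation K :: "'i \<Rightarrow> ('s cont_sym, 's comp_sym, 'e) fo_struct" where
  "K i \<equiv> space_sort (M i)"

abbreviation N :: "('f, 'p, 'i \<Rightarrow> 'h) fo_struct" where
  "N \<equiv> ultraproduct U (\<lambda>i. home (M i))"

definition const :: "'s \<Rightarrow> 'i \<Rightarrow> 'e" where
  "const s i = fun_int (K i) (const_sym S s) []"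

text \<open>A relation rather than a function, so that it makes sense for every family; existence
  and uniqueness are proved for families with components in the universes. Only unary compact sets
  are tested; \<open>tuple_std_in_compact\<close> extends the control to higher arities.\<close>

definition std :: "('i \<Rightarrow> 'e) \<Rightarrow> 's \<Rightarrow> bool" where
  "std x s \<longleftrightarrow> s \<in> topspace S \<and> (\<forall>C. compactin (space_pow S 1) C \<and>
     eventually (\<lambda>i. rel_int (K i) (1, C) [x i]) U \<longrightarrow> tuple [s] \<in> C)"

lemma structures:
  "fo_structure (home_lang L) (home (M i))" "fo_structure (space_lang S) (K i)"
  "\<And>g as es. g \<in> further L \<Longrightarrow> length as = fst (further_ar L g) \<Longrightarrow> set as \<subseteq> univ (home (M i)) \<Longrightarrow>
    length es = snd (further_ar L g) \<Longrightarrow> set es \<subseteq> univ (K i) \<Longrightarrow> further_int (M i) g as es \<in> univ (K i)"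
  using lstr[of i] by (auto simp: lstructure_def two_sorted_structure_def)

lemma ex_index: "eventually P U \<Longrightarrow> \<exists>i. P i"
  using ultra by (auto simp: ultrafilter_def dest: eventually_happens)

lemma closed_imp_compact: "closedin (space_pow S n) C \<Longrightarrow> compactin (space_pow S n) C"
  by (simp add: compactin_space_pow_iff compact Hausdorff)

lemma compact_imp_closed: "compactin (space_pow S n) C \<Longrightarrow> closedin (space_pow S n) C"
  by (simp add: compactin_space_pow_iff compact Hausdorff)

lemma compact_Int:
  "compactin (space_pow S n) C \<Longrightarrow> compactin (space_pow S n) D \<Longrightarrow> compactin (space_pow S n) (C \<inter> D)"
  by (simp add: compactin_space_pow_iff compact Hausdorff closedin_Int)

lemma transfer:
  assumes "wf_fm (space_lang S) \<phi>"
    and "\<And>v. range v \<subseteq> topspace S \<Longrightarrow> fm_sat (space_struct S) v \<phi>"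
    and "range w \<subseteq> univ (K i)"
  shows "fm_sat (K i) w \<phi>"
proof -
  have "fo_models (space_struct S) \<phi>" using assms(2) by (simp add: fo_models_def space_struct_def)
  then have "fo_models (K i) \<phi>"
    using elem_equiv_fo_models_iff[OF _ assms(1)] lstr[of i] by (auto simp: lstructure_def)
  then show ?thesis using assms(3) by (simp add: fo_models_def)
qed

text \<open>On an empty space even \<open>Neg (Eq (Var 0) (Var 0))\<close> is valid, there being no
  assignments, and it would transfer to the nonempty space sorts.\<close>

lemma topspace_nonempty: "topspace S \<noteq> {}"
proof
  assume "topspace S = {}"
  then have "fm_sat (K i) w (Neg (Eq (Var 0) (Var 0)))" if "range w \<subseteq> univ (K i)" for w i
    using that by (intro transfer) auto
  moreover obtain e where "e i \<in> univ (K i)" for i using fo_structure_ex[OF structures(2)] by metis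
  then have "range (\<lambda>_. e i) \<subseteq> univ (K i)" for i by auto
  ultimately show False by fastforce
qed

lemma assignment_of_list:
  assumes "set es \<subseteq> univ (K i)" "n = length es"
  obtains w where "range w \<subseteq> univ (K i)" "map w [0..<n] = es" "\<And>j. j < n \<Longrightarrow> w j = es ! j"
proof -
  obtain e where "e \<in> univ (K i)" using fo_structure_ex[OF structures(2)] by blast
  then have "range (\<lambda>j. if j < n then es ! j else e) \<subseteq> univ (K i)"
    using assms by (auto simp: subset_iff)
  moreover have "map (\<lambda>j. if j < n then es ! j else e) [0..<n] = es"
    using assms(2) by (intro nth_equalityI) auto
  ultimately show ?thesis by (rule that) simp
qed

lemma tuple_assignment_in_topspace:
  "range v \<subseteq> topspace S \<Longrightarrow> tuple (map v [0..<n]) \<in> topspace (space_pow S n)"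
  using tuple_in_topspace_iff[of "map v [0..<n]" S] by auto

section \<open>Laws of compact relations in the space sorts of the family\<close>

lemma rel_empty:
  assumes "1 \<le> n" "length es = n" "set es \<subseteq> univ (K i)"
  shows "\<not> rel_int (K i) (n, {}) es"
proof -
  obtain w where w: "range w \<subseteq> univ (K i)" "map w [0..<n] = es"
    by (rule assignment_of_list[of es i n]) (use assms in auto)
  have "fm_sat (K i) w (Neg (Rel (n, {}) (map Var [0..<n])))"
    by (rule transfer) (use assms w in \<open>auto simp: space_lang_def space_struct_def\<close>)
  then show ?thesis using w by (simp add: comp_def)
qed

lemma rel_Int:
  assumes "1 \<le> n" "compactin (space_pow S n) C" "compactin (space_pow S n) D"
    "length es = n" "set es \<subseteq> univ (K i)" "rel_int (K i) (n, C) es" "rel_int (K i) (n, D) es"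
  shows "rel_int (K i) (n, C \<inter> D) es"
proof -
  obtain w where w: "range w \<subseteq> univ (K i)" "map w [0..<n] = es"
    using assignment_of_list[OF assms(5) assms(4)[symmetric]] by blast
  let ?R = "\<lambda>C. Rel (n, C) (map Var [0..<n])"
  have "compactin (space_pow S n) (C \<inter> D)"
    using assms by (intro compact_Int)
  then have "fm_sat (K i) w (Disj (?R (C \<inter> D)) (Disj (Neg (?R C)) (Neg (?R D))))"
    by (intro transfer[OF _ _ w(1)])
      (use assms(1-3) in \<open>auto simp: space_lang_def space_struct_def\<close>)
  then show ?thesis using w(2) assms(6,7) by (simp add: comp_def)
qed

lemma rel_Un:
  assumes "1 \<le> n" "compactin (space_pow S n) C" "compactin (space_pow S n) D"
    "topspace (space_pow S n) \<subseteq> C \<union> D" "length es = n" "set es \<subseteq> univ (K i)"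
  shows "rel_int (K i) (n, C) es \<or> rel_int (K i) (n, D) es"
proof -
  obtain w where w: "range w \<subseteq> univ (K i)" "map w [0..<n] = es"
    using assignment_of_list[OF assms(6) assms(5)[symmetric]] by blast
  let ?R = "\<lambda>C. Rel (n, C) (map Var [0..<n])"
  have "fm_sat (K i) w (Disj (?R C) (?R D))"
  proof (rule transfer[OF _ _ w(1)])
    fix v :: "nat \<Rightarrow> 's" assume "range v \<subseteq> topspace S"
    from tuple_assignment_in_topspace[OF this, of n] assms(4)
    show "fm_sat (space_struct S) v (Disj (?R C) (?R D))"
      by (auto simp: space_struct_def comp_def)
  qed (use assms(1-3) in \<open>auto simp: space_lang_def\<close>)
  then show ?thesis using w(2) by (simp add: comp_def)
qed

lemma rel_diagonal:
  assumes "e \<in> univ (K i)"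
  shows "rel_int (K i) (2, diagonal S 1) [e, e]"
proof -
  have "fm_sat (K i) (\<lambda>_. e) (Rel (2, diagonal S 1) [Var 0, Var 0])"
  proof (rule transfer)
    show "wf_fm (space_lang S) (Rel (2, diagonal S 1) [Var 0, Var 0])"
      using closed_imp_compact[OF closedin_diagonal[OF Hausdorff]] by (simp add: space_lang_def)
    fix v :: "nat \<Rightarrow> 's" assume "range v \<subseteq> topspace S"
    then have "tuple [v 0, v 0] \<in> topspace (space_pow S 2)"
      by (auto simp: pair_in_topspace_iff)
    then show "fm_sat (space_struct S) v (Rel (2, diagonal S 1) [Var 0, Var 0])"
      by (simp add: space_struct_def diagonal_def tuple_nth)
  qed (use assms in auto)
  then show ?thesis by simp
qed

lemma const_in_univ: "s \<in> topspace S \<Longrightarrow> const s i \<in> univ (K i)"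
  by (simp add: const_def fo_structure_fun_int[OF structures(2)] const_sym_in_funs fun_ar_const_sym)

lemma consts_in_univ: "set ss \<subseteq> topspace S \<Longrightarrow> set (map (\<lambda>s. const s i) ss) \<subseteq> univ (K i)"
  using const_in_univ by auto

text \<open>The atomic sentence about the constants transfers if it is true in \<open>S\<close>, and
  its negation transfers otherwise. The constants thus form a copy of \<open>S\<close> inside every
  space sort.\<close>

lemma rel_consts_iff:
  assumes "1 \<le> length ss" "set ss \<subseteq> topspace S" "compactin (space_pow S (length ss)) C"
  shows "rel_int (K i) (length ss, C) (map (\<lambda>s. const s i) ss) \<longleftrightarrow> tuple ss \<in> C"
proof -
  let ?\<phi> = "Rel (length ss, C) (map (\<lambda>s. Fn (const_sym S s) []) ss)"
  have wf: "wf_fm (space_lang S) ?\<phi>"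
    using assms const_sym_in_funs by (auto simp: fun_ar_const_sym space_lang_def const_sym_def)
  have S: "fm_sat (space_struct S) v ?\<phi> \<longleftrightarrow> tuple ss \<in> C" for v
    by (simp add: fun_int_const_sym comp_def) (simp add: space_struct_def)
  obtain w :: "nat \<Rightarrow> 'e" where w: "range w \<subseteq> univ (K i)"
    using assignment_of_list[of "[]" i 0] by auto
  have K: "fm_sat (K i) w ?\<phi> \<longleftrightarrow> rel_int (K i) (length ss, C) (map (\<lambda>s. const s i) ss)"
    by (simp add: comp_def const_def)
  show ?thesis
  proof (cases "tuple ss \<in> C")
    case True
    then show ?thesis using transfer[OF wf _ w] S K by simp
  next
    case False
    then have "fm_sat (K i) w (Neg ?\<phi>)" using wf S w by (intro transfer) auto
    then show ?thesis using False K by simp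
  qed
qed

section \<open>Existence, uniqueness and tuples of standard parts\<close>

lemma std_const:
  assumes "s \<in> topspace S"
  shows "std (const s) s"
  using assms rel_consts_iff[of "[s]"] ultra
  by (auto simp: std_def ultrafilter_def)

text \<open>Compactness of \<open>S\<close>: the compact sets to which the family belongs along
  \<open>U\<close> are closed under finite intersections, and the empty set is not among them, so
  they have a common point.\<close>

lemma std_exists:
  assumes x: "\<And>i. x i \<in> univ (K i)"
  obtains s where "std x s"
proof -
  let ?D = "{C. compactin (space_pow S 1) C \<and> eventually (\<lambda>i. rel_int (K i) (1, C) [x i]) U}"
  have top: "topspace (space_pow S 1) \<in> ?D"
  proof -
    have c: "compactin (space_pow S 1) (topspace (space_pow S 1))"
      by (intro closed_imp_compact) simp
    then have "rel_int (K i) (1, topspace (space_pow S 1)) [x i]" for i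
      using rel_Un[of 1 "topspace (space_pow S 1)" "topspace (space_pow S 1)" "[x i]" i] x by auto
    then show ?thesis using c by simp
  qed
  \<comment> \<open>The factor \<open>topspace\<close> covers the empty family, whose intersection
    would otherwise be the whole type.\<close>
  have Int: "topspace (space_pow S 1) \<inter> \<Inter>\<F> \<in> ?D" if "finite \<F>" "\<F> \<subseteq> ?D" for \<F>
    using that
  proof (induction \<F>)
    case empty
    then show ?case using top by simp
  next
    case (insert C \<F>)
    let ?E = "topspace (space_pow S 1) \<inter> \<Inter>\<F>"
    have E: "?E \<in> ?D" and C: "C \<in> ?D" using insert by auto
    then have "eventually (\<lambda>i. rel_int (K i) (1, C) [x i]) U"
      "eventually (\<lambda>i. rel_int (K i) (1, ?E) [x i]) U" by auto
    then have "eventually (\<lambda>i. rel_int (K i) (1, C \<inter> ?E) [x i]) U"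
      by eventually_elim (use C E x in \<open>auto intro!: rel_Int\<close>)
    moreover have "compactin (space_pow S 1) (C \<inter> ?E)"
      using C E by (intro compact_Int[of 1 C ?E]) blast+
    moreover have "C \<inter> ?E = topspace (space_pow S 1) \<inter> \<Inter>(insert C \<F>)" by auto
    ultimately show ?case by simp
  qed
  have "{} \<notin> ?D"
    using rel_empty[of 1 "[x i]" i for i] x ex_index by fastforce
  then have fip: "\<forall>\<F>. finite \<F> \<and> \<F> \<subseteq> ?D \<longrightarrow> \<Inter>\<F> \<noteq> {}" using Int by fastforce
  have closed: "\<forall>C\<in>?D. closedin (space_pow S 1) C" using compact_imp_closed by auto
  have "(\<forall>C\<in>?D. closedin (space_pow S 1) C) \<and> (\<forall>\<F>. finite \<F> \<and> \<F> \<subseteq> ?D \<longrightarrow> \<Inter>\<F> \<noteq> {})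
    \<longrightarrow> \<Inter>?D \<noteq> {}"
    using compact_space_pow[OF compact, of 1] unfolding compact_space_fip by (rule spec)
  from mp[OF this conjI[OF closed fip]] have "\<Inter>?D \<noteq> {}" .
  then obtain p where p: "\<And>C. C \<in> ?D \<Longrightarrow> p \<in> C" by blast
  then have "p \<in> topspace (space_pow S 1)" using top by blast
  \<comment> \<open>The common point lives in the first power of \<open>S\<close>; by extensionality
    it is determined by its entry at 0.\<close>
  then have "p \<in> extensional {..<1}" "p 0 \<in> topspace S" by (auto simp: space_pow_def PiE_iff)
  moreover from this have "tuple [p 0] = p" using tuple_map_upt[of p 1] by simp
  ultimately have "std x (p 0)" using p by (auto simp: std_def)
  then show ?thesis by (rule that)
qed

lemma tuple_std_in_topspace:
  assumes "list_all2 std xs ss"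
  shows "set ss \<subseteq> topspace S" "tuple ss \<in> topspace (space_pow S (length ss))"
proof -
  show "set ss \<subseteq> topspace S" using assms by (auto simp: list_all2_conv_all_nth set_conv_nth std_def)
  then show "tuple ss \<in> topspace (space_pow S (length ss))" by (simp add: tuple_in_topspace_iff)
qed

text \<open>A basic open box around the tuple of standard parts which avoids \<open>C\<close> has sides whose
  complements the components of the family avoid along the ultrafilter; that \<open>C\<close> is covered by
  the cylinders over these complements transfers.\<close>

lemma tuple_std_in_compact:
  assumes std: "list_all2 std xs ss" and n: "n = length ss" "1 \<le> n"
    and xs: "\<And>x i. x \<in> set xs \<Longrightarrow> x i \<in> univ (K i)"
    and C: "compactin (space_pow S n) C"
    and ev: "eventually (\<lambda>i. rel_int (K i) (n, C) (map (\<lambda>x. x i) xs)) U"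
  shows "tuple ss \<in> C"
proof (rule ccontr)
  assume "tuple ss \<notin> C"
  then have "tuple ss \<in> topspace (space_pow S n) - C"
    using tuple_std_in_topspace[OF std] n by auto
  moreover have "openin (space_pow S n) (topspace (space_pow S n) - C)"
    using compact_imp_closed[OF C] by auto
  ultimately obtain V where V: "\<And>j. j < n \<Longrightarrow> openin S (V j)" "tuple ss \<in> Pi\<^sub>E {..<n} V"
    "Pi\<^sub>E {..<n} V \<subseteq> topspace (space_pow S n) - C"
    unfolding space_pow_def openin_product_topology_alt by (metis lessThan_iff)
  have len: "length xs = n" using std n by (simp add: list_all2_lengthD)
  define D where "D j = {p \<in> topspace (space_pow S 1). p 0 \<in> topspace S - V j}" for j
  have D: "compactin (space_pow S 1) (D j)" if "j < n" for j
    unfolding D_def using V(1)[OF that] continuous_map_space_pow_component[of 0 1 S]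
    by (intro closed_imp_compact closedin_continuous_map_preimage) auto
  have "eventually (\<lambda>i. \<not> rel_int (K i) (1, D j) [(xs ! j) i]) U" if j: "j < n" for j
  proof -
    have "std (xs ! j) (ss ! j)" using std j len by (simp add: list_all2_nthD)
    moreover have "tuple [ss ! j] \<notin> D j"
      using V(2) j n by (auto simp: D_def tuple_def PiE_iff)
    ultimately show ?thesis using D[OF j] by (auto simp: std_def ultrafilter_not_iff[OF ultra])
  qed
  then have "eventually (\<lambda>i. \<forall>j\<in>{..<n}. \<not> rel_int (K i) (1, D j) [(xs ! j) i]) U"
    by (intro eventually_ball_finite) auto
  with ev have "eventually (\<lambda>i. rel_int (K i) (n, C) (map (\<lambda>x. x i) xs) \<and>
    (\<forall>j\<in>{..<n}. \<not> rel_int (K i) (1, D j) [(xs ! j) i])) U" by (rule eventually_conj)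
  then obtain i where i: "rel_int (K i) (n, C) (map (\<lambda>x. x i) xs)"
    "\<And>j. j < n \<Longrightarrow> \<not> rel_int (K i) (1, D j) [(xs ! j) i]" using ex_index by fastforce
  \<comment> \<open>With \<open>n\<close> fixed this is a single formula: the tuple avoids
    \<open>C\<close>, or one of its coordinates \<open>j\<close> lies in \<open>D j\<close>. It
    fails at the index \<open>i\<close>.\<close>
  let ?\<phi> = "foldr Disj (map (\<lambda>j. Rel (1, D j) [Var j]) [0..<n]) (Neg (Rel (n, C) (map Var [0..<n])))"
  obtain w where w: "range w \<subseteq> univ (K i)" "map w [0..<n] = map (\<lambda>x. x i) xs"
    "\<And>j. j < n \<Longrightarrow> w j = (xs ! j) i"
    using assignment_of_list[of "map (\<lambda>x. x i) xs" i n] xs len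
    by (metis (no_types, lifting) image_subsetI length_map list.set_map nth_map)
  have "fm_sat (K i) w ?\<phi>"
  proof (rule transfer[OF _ _ w(1)])
    show "wf_fm (space_lang S) ?\<phi>"
      using n C D by (auto simp: wf_fm_foldr_Disj space_lang_def)
    fix v :: "nat \<Rightarrow> 's" assume v: "range v \<subseteq> topspace S"
    show "fm_sat (space_struct S) v ?\<phi>"
    proof (rule ccontr)
      assume "\<not> fm_sat (space_struct S) v ?\<phi>"
      then have *: "tuple (map v [0..<n]) \<in> C" "\<And>j. j < n \<Longrightarrow> tuple [v j] \<notin> D j"
        by (auto simp: fm_sat_foldr_Disj space_struct_def comp_def)
      have "v j \<in> V j" if "j < n" for j
        using *(2)[OF that] v tuple_in_topspace_iff[of "[v j]" S]
        by (auto simp: D_def tuple_nth)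
      then have "tuple (map v [0..<n]) \<in> Pi\<^sub>E {..<n} V" by (auto simp: tuple_def)
      then show False using V(3) *(1) by auto
    qed
  qed
  then show False using i w by (auto simp: fm_sat_foldr_Disj comp_def)
qed

text \<open>A converse for interior points, obtained from \<open>tuple_std_in_compact\<close> for
  the complement of the interior: this set is compact, misses the tuple, and covers the power
  together with \<open>C\<close>. At a boundary point of \<open>C\<close> the family could lie just
  outside.\<close>

lemma eventually_rel_of_tuple_std:
  assumes std: "list_all2 std xs ss" and n: "n = length ss" "1 \<le> n"
    and xs: "\<And>x i. x \<in> set xs \<Longrightarrow> x i \<in> univ (K i)"
    and C: "compactin (space_pow S n) C" "tuple ss \<in> space_pow S n interior_of C"
  shows "eventually (\<lambda>i. rel_int (K i) (n, C) (map (\<lambda>x. x i) xs)) U"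
proof -
  let ?C' = "topspace (space_pow S n) - space_pow S n interior_of C"
  have C': "compactin (space_pow S n) ?C'" by (intro closed_imp_compact closedin_diff) auto
  have len: "length xs = n" using std n by (simp add: list_all2_lengthD)
  have "\<not> eventually (\<lambda>i. rel_int (K i) (n, ?C') (map (\<lambda>x. x i) xs)) U"
  proof
    assume "eventually (\<lambda>i. rel_int (K i) (n, ?C') (map (\<lambda>x. x i) xs)) U"
    then have "tuple ss \<in> ?C'" by (intro tuple_std_in_compact[OF std n _ C']) (rule xs)
    then show False using C(2) by blast
  qed
  then have "eventually (\<lambda>i. \<not> rel_int (K i) (n, ?C') (map (\<lambda>x. x i) xs)) U"
    by (simp add: ultrafilter_not_iff[OF ultra])
  moreover have "rel_int (K i) (n, C) (map (\<lambda>x. x i) xs) \<or> rel_int (K i) (n, ?C') (map (\<lambda>x. x i) xs)"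
    for i
    using xs len interior_of_subset[of "space_pow S n" C] by (intro rel_Un n C C') auto
  ultimately show ?thesis by (auto elim!: eventually_mono)
qed

lemma std_cong:
  assumes "std x s" "eventually (\<lambda>i. x i = y i) U"
  shows "std y s"
proof -
  have "eventually (\<lambda>i. rel_int (K i) (1, C) [y i]) U \<Longrightarrow> eventually (\<lambda>i. rel_int (K i) (1, C) [x i]) U"
    for C using assms(2) by (auto elim: eventually_elim2)
  then show ?thesis using assms(1) by (auto simp: std_def)
qed

lemma std_pair_in_compact:
  assumes "std x s" "std y t" "\<And>i. x i \<in> univ (K i)" "\<And>i. y i \<in> univ (K i)"
    and "compactin (space_pow S 2) C" "eventually (\<lambda>i. rel_int (K i) (2, C) [x i, y i]) U"
  shows "tuple [s, t] \<in> C"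
  using tuple_std_in_compact[of "[x, y]" "[s, t]" 2 C] assms by auto

text \<open>Since \<open>S\<close> is Hausdorff, the diagonal is a compact relation; it holds
  between a family and itself, hence between any two of its standard parts.\<close>

lemma std_unique:
  assumes "std x s" "std x t" "\<And>i. x i \<in> univ (K i)"
  shows "s = t"
proof -
  have "tuple [s, t] \<in> diagonal S 1"
    using assms rel_diagonal closed_imp_compact[OF closedin_diagonal[OF Hausdorff]]
    by (intro std_pair_in_compact[of x _ x]) auto
  then show ?thesis by (auto simp: diagonal_def tuple_nth)
qed

text \<open>For distinct points, regularity of the square separates the pair from the diagonal by
  disjoint open sets; the complement of the open set around the pair is a compact neighbourhood of
  the diagonal that misses the pair.\<close>

lemma eq_if_in_all_diag_nbhds:
  assumes "s \<in> topspace S" "t \<in> topspace S"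
    and "\<And>\<epsilon>. compact_diag_nbhd S 1 \<epsilon> \<Longrightarrow> tuple [s, t] \<in> \<epsilon>"
  shows "s = t"
proof (rule ccontr)
  assume "s \<noteq> t"
  let ?X = "space_pow S 2"
  have "tuple [s, t] \<in> topspace ?X - diagonal S 1"
    using assms(1,2) \<open>s \<noteq> t\<close> by (auto simp: pair_in_topspace_iff diagonal_def tuple_nth)
  moreover have "regular_space ?X"
    by (intro compact_Hausdorff_imp_regular_space compact_space_pow Hausdorff_space_pow
        compact Hausdorff)
  ultimately obtain V W where VW: "openin ?X V" "openin ?X W" "tuple [s, t] \<in> V"
    "diagonal S 1 \<subseteq> W" "disjnt V W"
    using closedin_diagonal[OF Hausdorff] unfolding regular_space_def by meson
  have "W \<subseteq> ?X interior_of (topspace ?X - V)"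
    using VW openin_subset[OF VW(2)] by (intro interior_of_maximal) (auto simp: disjnt_def)
  moreover have "compactin ?X (topspace ?X - V)" using VW by (intro closed_imp_compact) auto
  ultimately have "compact_diag_nbhd S 1 (topspace ?X - V)"
    using VW by (auto simp: compact_diag_nbhd_def)
  then show False using assms(3) VW(3) by blast
qed

section \<open>Compatibility of the symbols with standard parts\<close>

lemma ssym_int_in_univ:
  assumes "f \<in> ssyms S L" "length as = home_ar L f" "set as \<subseteq> univ (home (M i))"
    "length es = space_ar L f" "set es \<subseteq> univ (K i)"
  shows "ssym_int (M i) f as es \<in> univ (K i)"
proof (cases f)
  case (Cont c)
  then have "c \<in> funs (space_lang S)" using assms(1) by (auto simp: ssyms_def)
  moreover have "fun_ar (space_lang S) c = fst c" by (simp add: space_lang_def)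
  ultimately show ?thesis using assms Cont by (auto intro!: fo_structure_fun_int[OF structures(2)])
next
  case (Further g)
  then show ?thesis using assms structures(3)[of g as i es] by (auto simp: ssyms_def)
qed

text \<open>The place where the common modulus is decisive. The pair (\<open>ss\<close>,
  \<open>ss\<close>) lies on the diagonal, hence in the interior of the single \<delta> given by
  \<open>\<Delta>\<close>, so \<open>xs\<close> and the constants are \<delta>-close along
  \<open>U\<close>. Equicontinuity at each such index makes the values \<epsilon>-close, and the
  standard parts inherit this as \<epsilon> is compact. Letting \<epsilon> vary, the standard parts
  coincide.\<close>

lemma std_ssym_int_cong:
  assumes f: "f \<in> ssyms S L"
    and as: "length as = home_ar L f" "\<And>i. set (map (\<lambda>a. a i) as) \<subseteq> univ (home (M i))"
    and xs: "length ss = space_ar L f" "list_all2 std xs ss" "\<And>x i. x \<in> set xs \<Longrightarrow> x i \<in> univ (K i)"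
    and t: "std (\<lambda>i. ssym_int (M i) f (map (\<lambda>a. a i) as) (map (\<lambda>s. const s i) ss)) t"
  shows "std (\<lambda>i. ssym_int (M i) f (map (\<lambda>a. a i) as) (map (\<lambda>x. x i) xs)) t"
proof -
  let ?m = "space_ar L f"
  let ?y = "\<lambda>i. ssym_int (M i) f (map (\<lambda>a. a i) as) (map (\<lambda>x. x i) xs)"
  let ?z = "\<lambda>i. ssym_int (M i) f (map (\<lambda>a. a i) as) (map (\<lambda>s. const s i) ss)"
  note ss = tuple_std_in_topspace[OF xs(2)]
  have len: "length xs = ?m" using xs by (simp add: list_all2_lengthD)
  have y: "?y i \<in> univ (K i)" for i
    using f as xs len by (intro ssym_int_in_univ) auto
  have z: "?z i \<in> univ (K i)" for i
    using f as xs ss(1) const_in_univ by (intro ssym_int_in_univ) auto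
  show ?thesis
  \<comment> \<open>Without space arguments \<open>equicont_at\<close> says nothing, but then both
    argument lists are empty and the two families are the same.\<close>
  proof (cases "?m = 0")
    case True
    then have "ss = []" "xs = []" using xs(1) len by auto
    then show ?thesis using t by simp
  next
    case False
    obtain r where r: "std ?y r" using std_exists[of ?y, OF y] by blast
    have "r = t"
    proof (rule eq_if_in_all_diag_nbhds)
      show "r \<in> topspace S" "t \<in> topspace S" using r t by (auto simp: std_def)
      fix \<epsilon> assume \<epsilon>: "compact_diag_nbhd S 1 \<epsilon>"
      let ?\<delta> = "\<Delta> f \<epsilon>"
      have eq: "equicont_at S L (M i) f \<epsilon> ?\<delta>" for i using mod[of i] f \<epsilon> by (auto simp: modulus_def)
      then have \<delta>: "compact_diag_nbhd S ?m ?\<delta>" using False by (auto simp: equicont_at_def Let_def)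
      have "list_all2 std (xs @ map const ss) (ss @ ss)"
        using xs(2) ss(1) std_const by (intro list_all2_appendI) (auto simp: list.rel_map list_all2_same)
      moreover have "tuple (ss @ ss) \<in> diagonal S ?m"
        using tuple_in_topspace_iff[of "ss @ ss" S] ss(1) xs(1)
        by (auto simp: diagonal_def tuple_nth nth_append mult_2)
      ultimately have "eventually (\<lambda>i. rel_int (K i) (2 * ?m, ?\<delta>)
        (map (\<lambda>x. x i) (xs @ map const ss))) U"
        using \<delta> False xs ss(1) const_in_univ
        by (intro eventually_rel_of_tuple_std) (auto simp: compact_diag_nbhd_def)
      then have "eventually (\<lambda>i. rel_int (K i) (2, \<epsilon>) [?y i, ?z i]) U"
      proof eventually_elim
        case (elim i)
        have "set (map (\<lambda>x. x i) xs) \<subseteq> univ (K i)" "set (map (\<lambda>s. const s i) ss) \<subseteq> univ (K i)"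
          using xs ss(1) const_in_univ by auto
        then show ?case using eq[of i] False elim as(1) as(2)[of i] len xs(1)
          unfolding equicont_at_def Let_def by (auto simp: comp_def)
      qed
      then show "tuple [r, t] \<in> \<epsilon>"
        using r t y z \<epsilon> by (intro std_pair_in_compact) (auto simp: compact_diag_nbhd_def)
    qed
    then show ?thesis using r by simp
  qed
qed

section \<open>The standard structure and its modulus\<close>

definition std_struct :: "('f, 'p, 'g, 's, 'i \<Rightarrow> 'h, 's) lstruct" where
  "std_struct = \<lparr>
     home = N,
     space_sort = space_struct S,
     r_int = (\<lambda>n \<phi> as. eventually (\<lambda>i. r_int (M i) n \<phi> (map (\<lambda>a. a i) as)) U),
     further_int = (\<lambda>g as ss. THE t.
       std (\<lambda>i. further_int (M i) g (map (\<lambda>a. a i) as) (map (\<lambda>s. const s i) ss)) t)\<rparr>"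

lemma home_component:
  assumes "set as \<subseteq> univ N"
  shows "set (map (\<lambda>a. a i) as) \<subseteq> univ (home (M i))"
  using assms ultraproduct_univ_component[of _ U "\<lambda>i. home (M i)"] by auto

lemma std_ssym_int_const:
  assumes f: "f \<in> ssyms S L" and as: "length as = home_ar L f" "set as \<subseteq> univ N"
    and ss: "length ss = space_ar L f" "set ss \<subseteq> topspace S"
  shows "std (\<lambda>i. ssym_int (M i) f (map (\<lambda>a. a i) as) (map (\<lambda>s. const s i) ss)) (ssym_int std_struct f as ss)"
proof (cases f)
  case (Further g)
  let ?y = "\<lambda>i. ssym_int (M i) f (map (\<lambda>a. a i) as) (map (\<lambda>s. const s i) ss)"
  have y: "?y i \<in> univ (K i)" for i
    using f as ss const_in_univ home_component[OF as(2)] by (intro ssym_int_in_univ) auto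
  obtain t where t: "std ?y t" using std_exists[of ?y, OF y] by blast
  \<comment> \<open>Existence and uniqueness of standard parts justify the description in
    \<open>std_struct\<close> for arguments of the right arities in the universes.\<close>
  have "std ?y (THE t. std ?y t)" 
    by (rule theI[of "std ?y", OF t]) (rule std_unique[of ?y, OF _ t y])
  then show ?thesis by (simp add: Further std_struct_def)
next
  case (Cont c)
  obtain n h where c: "c = (n, h)" by fastforce
  have h: "(n, h) \<in> funs (space_lang S)" using f Cont c by (auto simp: ssyms_def)
  have n: "length ss = n" using ss Cont c by simp
  have hs: "h (tuple ss) \<in> topspace S"
    using h ss n tuple_in_topspace_iff[of ss S]
    by (auto simp: space_lang_def dest!: continuous_map_funspace)
  \<comment> \<open>The value of \<open>h\<close> at named points is itself a named point. This
    equation transfers, so the family of values is a family of constants with known standard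
    part.\<close>
  let ?\<phi> = "Eq (Fn (n, h) (map (\<lambda>s. Fn (const_sym S s) []) ss)) (Fn (const_sym S (h (tuple ss))) [])"
  have "fun_int (K i) (n, h) (map (\<lambda>s. const s i) ss) = const (h (tuple ss)) i" for i
  proof -
    obtain w :: "nat \<Rightarrow> 'e" where w: "range w \<subseteq> univ (K i)"
    using assignment_of_list[of "[]" i 0] by auto
    have "const_sym S s \<in> funs (space_lang S)" if "s \<in> set ss" for s
      using that ss(2) by (intro const_sym_in_funs) auto
    moreover have "fun_ar (space_lang S) (n, h) = n" by (simp add: space_lang_def)
    ultimately have "wf_fm (space_lang S) ?\<phi>"
      using h n const_sym_in_funs[OF hs] by (simp add: fun_ar_const_sym)
    moreover have "fm_sat (space_struct S) v ?\<phi>" for v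
      by (simp add: fun_int_const_sym comp_def) (simp add: space_struct_def)
    ultimately have "fm_sat (K i) w ?\<phi>" using w by (intro transfer)
    then show ?thesis by (simp add: const_def comp_def)
  qed
  then show ?thesis using std_const[OF hs] by (simp add: Cont c std_struct_def space_struct_def)
qed

lemma ssym_int_std_struct_in_topspace:
  assumes "f \<in> ssyms S L" "length as = home_ar L f" "set as \<subseteq> univ N"
    "length ss = space_ar L f" "set ss \<subseteq> topspace S"
  shows "ssym_int std_struct f as ss \<in> topspace S"
  using std_ssym_int_const[OF assms] by (simp add: std_def)

text \<open>Points that are \<delta>-close in \<open>S\<close> have \<delta>-close constants at
  every index. Their values are \<epsilon>-close there, and compactness of \<epsilon> hands this to
  the standard parts, so the same \<open>\<Delta>\<close> works in the limit.\<close>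

lemma std_struct_modulus: "modulus S L std_struct \<Delta>"
  unfolding modulus_def
proof (intro ballI allI impI)
  fix f \<epsilon> assume f: "f \<in> ssyms S L" and \<epsilon>: "compact_diag_nbhd S 1 \<epsilon>"
  let ?m = "space_ar L f"
  let ?\<delta> = "\<Delta> f \<epsilon>"
  have eq: "equicont_at S L (M i) f \<epsilon> ?\<delta>" for i using mod[of i] f \<epsilon> by (auto simp: modulus_def)
  have "tuple [ssym_int std_struct f as ss, ssym_int std_struct f as ss'] \<in> \<epsilon>"
    if m: "0 < ?m" and as: "length as = home_ar L f" "set as \<subseteq> univ N"
      and ss: "length ss = ?m" "set ss \<subseteq> topspace S" and ss': "length ss' = ?m" "set ss' \<subseteq> topspace S"
      and \<delta>: "tuple (ss @ ss') \<in> ?\<delta>" for as ss ss'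
  proof (rule std_pair_in_compact)
    let ?y = "\<lambda>ss i. ssym_int (M i) f (map (\<lambda>a. a i) as) (map (\<lambda>s. const s i) ss)"
    show "std (?y ss) (ssym_int std_struct f as ss)" "std (?y ss') (ssym_int std_struct f as ss')"
      using std_ssym_int_const f as ss ss' by auto
    show "?y ss i \<in> univ (K i)" for i
      by (rule ssym_int_in_univ[OF f _ home_component[OF as(2)] _ consts_in_univ[OF ss(2)]])
        (simp_all add: as ss)
    show "?y ss' i \<in> univ (K i)" for i
      by (rule ssym_int_in_univ[OF f _ home_component[OF as(2)] _ consts_in_univ[OF ss'(2)]])
        (simp_all add: as ss')
    show "compactin (space_pow S 2) \<epsilon>" using \<epsilon> by (simp add: compact_diag_nbhd_def)
    have "compactin (space_pow S (2 * ?m)) ?\<delta>"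
      using eq m by (auto simp: equicont_at_def Let_def compact_diag_nbhd_def)
    then have "rel_int (K i) (2 * ?m, ?\<delta>) (map (\<lambda>s. const s i) ss @ map (\<lambda>s. const s i) ss')" for i
      using rel_consts_iff[of "ss @ ss'" ?\<delta> i] \<delta> m ss ss' by (simp add: mult_2)
    moreover have "set (map (\<lambda>s. const s i) ss) \<subseteq> univ (K i)" "set (map (\<lambda>s. const s i) ss') \<subseteq> univ (K i)"
      for i using ss ss' const_in_univ by auto
    ultimately have "rel_int (K i) (2, \<epsilon>) [?y ss i, ?y ss' i]" for i
      using eq[of i] m as(1) home_component[OF as(2), of i] ss(1) ss'(1)
      unfolding equicont_at_def Let_def by (metis length_map)
    then show "eventually (\<lambda>i. rel_int (K i) (2, \<epsilon>) [?y ss i, ?y ss' i]) U" by simp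
  qed
  moreover have "0 < ?m \<longrightarrow> compact_diag_nbhd S ?m ?\<delta>" using eq by (auto simp: equicont_at_def Let_def)
  moreover have "home std_struct = N" "space_sort std_struct = space_struct S"
    by (simp_all add: std_struct_def)
  ultimately show "equicont_at S L std_struct f \<epsilon> ?\<delta>"
    by (auto simp: equicont_at_def Let_def space_struct_def)
qed

lemma standard_structure_std_struct: "standard_structure S L std_struct"
proof -
  have "fo_structure (space_lang S) (space_struct S)"
    unfolding fo_structure_def
  proof (intro conjI ballI allI impI)
    show "univ (space_struct S) \<noteq> {}" using topspace_nonempty by (simp add: space_struct_def)
    fix c ss assume "c \<in> funs (space_lang S)"
      and "length ss = fun_ar (space_lang S) c \<and> set ss \<subseteq> univ (space_struct S)"
    then show "fun_int (space_struct S) c ss \<in> univ (space_struct S)"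
      using ssym_int_std_struct_in_topspace[of "Cont c" "[]" ss]
      by (auto simp: ssyms_def std_struct_def space_struct_def space_lang_def)
  qed
  moreover have "fo_structure (home_lang L) N" by (intro fo_structure_ultraproduct structures)
  moreover have "further_int std_struct g as ss \<in> topspace S"
    if "g \<in> further L" "length as = fst (further_ar L g)" "set as \<subseteq> univ N"
      "length ss = snd (further_ar L g)" "set ss \<subseteq> topspace S" for g as ss
    using ssym_int_std_struct_in_topspace[of "Further g" as ss] that by (auto simp: ssyms_def)
  ultimately have "two_sorted_structure S L std_struct"
    by (auto simp: two_sorted_structure_def std_struct_def space_struct_def)
  \<comment> \<open>The axiom for \<open>r_int\<close> at each index turns the left side into
    satisfaction along \<open>U\<close>, to which \<open>Los_theorem\<close> applies.\<close>
  moreover have "r_int std_struct n \<phi> (map v [0..<n]) \<longleftrightarrow> fm_sat N v \<phi>"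
    if "wf_fm (home_lang L) \<phi>" "fv_fm \<phi> \<subseteq> {..<n}" "range v \<subseteq> univ N" for n \<phi> v
  proof -
    have "range (\<lambda>x. v x i) \<subseteq> univ (home (M i))" for i
      using that(3) ultraproduct_univ_component[of _ U "\<lambda>i. home (M i)"] by auto
    then have "r_int (M i) n \<phi> (map (\<lambda>x. v x i) [0..<n]) \<longleftrightarrow> fm_sat (home (M i)) (\<lambda>x. v x i) \<phi>" for i
      using lstr[of i] that by (auto simp: lstructure_def)
    moreover have "fm_sat N v \<phi> \<longleftrightarrow> eventually (\<lambda>i. fm_sat (home (M i)) (\<lambda>x. v x i) \<phi>) U"
      using Los_theorem[OF ultra structures(1) that(3,1)] .
    ultimately show ?thesis by (simp add: std_struct_def comp_def)
  qed
  moreover have "equicontinuous S L std_struct"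
    using std_struct_modulus by (auto simp: modulus_def equicontinuous_def)
  ultimately show ?thesis
    by (auto simp: standard_structure_def lstructure_def elem_equiv_def std_struct_def)
qed

section \<open>Terms and positive formulas in the limit\<close>

lemma stm_val_in_univ:
  assumes "range v \<subseteq> univ (home (M i))" "range w \<subseteq> univ (K i)" "wf_stm S L t"
  shows "stm_val (M i) v w t \<in> univ (K i)"
  using assms(3)
proof (induction t)
  case (SVar y)
  then show ?case using assms(2) by auto
next
  case (SFn f ts ss)
  then show ?case
    using tm_val_in_univ[OF structures(1) assms(1)] by (auto intro!: ssym_int_in_univ)
qed

lemma std_stm_val:
  assumes v: "range v \<subseteq> univ N" and w: "\<And>y i. w y i \<in> univ (K i)" "\<And>y. std (w y) (w' y)"
    and "wf_stm S L t"
  shows "std (\<lambda>i. stm_val (M i) (\<lambda>x. v x i) (\<lambda>y. w y i) t) (stm_val std_struct v w' t)"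
  using assms(4)
proof (induction t)
  case (SVar y)
  then show ?case using w by simp
next
  case (SFn f ts ss)
  let ?as = "map (tm_val N v) ts"
  let ?x = "\<lambda>t i. stm_val (M i) (\<lambda>x. v x i) (\<lambda>y. w y i) t"
  let ?ss = "map (stm_val std_struct v w') ss"
  have f: "f \<in> ssyms S L" and lens: "length ?as = home_ar L f" "length ?ss = space_ar L f"
    using SFn.prems by auto
  have as: "set ?as \<subseteq> univ N"
    using SFn.prems tm_val_in_univ[OF fo_structure_ultraproduct[of "home_lang L" "\<lambda>i. home (M i)"] v]
      structures(1) by auto
  have vi: "range (\<lambda>x. v x i) \<subseteq> univ (home (M i))" for i
    using v ultraproduct_univ_component[of _ U "\<lambda>i. home (M i)"] by auto
  have std: "list_all2 std (map ?x ss) ?ss"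
    using SFn by (auto simp: list.rel_map list_all2_same)
  have x: "?x t i \<in> univ (K i)" if "t \<in> set ss" for t i
    using that SFn.prems vi w by (intro stm_val_in_univ) auto
  have "std (\<lambda>i. ssym_int (M i) f (map (\<lambda>a. a i) ?as) (map (\<lambda>x. x i) (map ?x ss)))
    (ssym_int std_struct f ?as ?ss)"
    using x by (intro std_ssym_int_cong[OF f lens(1) home_component[OF as] lens(2) std]
        std_ssym_int_const[OF f lens(1) as lens(2) tuple_std_in_topspace(1)[OF std]]) auto
  \<comment> \<open>The home arguments so far are components of values in the ultraproduct; along
    \<open>U\<close> they are the values computed in the members of the family, and
    \<open>std_cong\<close> permits the exchange.\<close>
  moreover have "eventually (\<lambda>i. map (\<lambda>t. tm_val N v t i) ts = map (tm_val (home (M i)) (\<lambda>x. v x i)) ts) U"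
    by (rule eventually_map_eq, rule ultraproduct_tm_val[where L = "home_lang L"])
      (use SFn.prems v structures in auto)
  ultimately have "std (\<lambda>i. ssym_int (M i) f (map (tm_val (home (M i)) (\<lambda>x. v x i)) ts)
    (map (\<lambda>x. x i) (map ?x ss))) (ssym_int std_struct f ?as ?ss)"
    by (elim std_cong) (auto elim!: eventually_mono simp: comp_def cong: map_cong)
  then show ?case by (simp add: comp_def std_struct_def)
qed

text \<open>Only this implication can be expected, since compact relations between families become
  weaker conditions on standard parts. The induction runs over arbitrary \<open>w\<close> above
  \<open>w'\<close>: a universal space quantifier is tested at constant families, an existential one
  returns a family of witnesses that need not be constant.\<close>

lemma positive_lfm_sat_std_struct:
  assumes "range v \<subseteq> univ N" "\<And>y i. w y i \<in> univ (K i)" "\<And>y. std (w y) (w' y)"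
    and "wf_lfm S L \<phi>" "positive_lfm \<phi>"
    and "eventually (\<lambda>i. lfm_sat (M i) (\<lambda>x. v x i) (\<lambda>y. w y i) \<phi>) U"
  shows "lfm_sat std_struct v w' \<phi>"
  using assms
proof (induction \<phi> arbitrary: v w w')
  case (HEq s t)
  have "fm_sat N v (Eq s t)"
    using HEq Los_theorem[where v = v and \<phi> = "Eq s t", OF ultra structures(1)] by simp
  then show ?case by (simp add: std_struct_def)
next
  case (HRel p ts)
  have "fm_sat N v (Rel p ts)"
    using HRel Los_theorem[where v = v and \<phi> = "Rel p ts", OF ultra structures(1)] by simp
  then show ?case by (simp add: std_struct_def)
next
  case (RRel n \<phi> ts)
  have "eventually (\<lambda>i. map (\<lambda>t. tm_val N v t i) ts = map (tm_val (home (M i)) (\<lambda>x. v x i)) ts) U"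
    by (rule eventually_map_eq, rule ultraproduct_tm_val[where L = "home_lang L"])
      (use RRel.prems structures in auto)
  with RRel.prems(6) show ?case
    by (auto simp: std_struct_def comp_def elim: eventually_elim2 cong: map_cong)
next
  case (SEq s t)
  let ?x = "\<lambda>t i. stm_val (M i) (\<lambda>x. v x i) (\<lambda>y. w y i) t"
  have vi: "range (\<lambda>x. v x i) \<subseteq> univ (home (M i))" for i
    using SEq.prems(1) ultraproduct_univ_component[of _ U "\<lambda>i. home (M i)"] by auto
  have "std (?x s) (stm_val std_struct v w' s)" "std (?x t) (stm_val std_struct v w' t)"
    using SEq.prems by (auto intro!: std_stm_val)
  \<comment> \<open>Equality along \<open>U\<close> makes both values standard parts of one and the
    same family.\<close>
  then have "std (?x t) (stm_val std_struct v w' s)" "std (?x t) (stm_val std_struct v w' t)"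
    using SEq.prems(6) std_cong by auto
  moreover have "?x t i \<in> univ (K i)" for i using SEq.prems vi by (intro stm_val_in_univ) auto
  ultimately show ?case using std_unique by simp
next
  case (SRel C ts)
  obtain n D where C: "C = (n, D)" by fastforce
  let ?x = "\<lambda>t i. stm_val (M i) (\<lambda>x. v x i) (\<lambda>y. w y i) t"
  have vi: "range (\<lambda>x. v x i) \<subseteq> univ (home (M i))" for i
    using SRel.prems(1) ultraproduct_univ_component[of _ U "\<lambda>i. home (M i)"] by auto
  have x: "?x t i \<in> univ (K i)" if "t \<in> set ts" for t i
    using that SRel.prems vi by (intro stm_val_in_univ) auto
  have std: "list_all2 std (map ?x ts) (map (stm_val std_struct v w') ts)"
    using SRel.prems by (auto simp: list.rel_map list_all2_same intro!: std_stm_val)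
  have "tuple (map (stm_val std_struct v w') ts) \<in> D"
    by (rule tuple_std_in_compact[OF std, of n])
      (use SRel.prems C x in \<open>auto simp: space_lang_def comp_def\<close>)
  then show ?case by (simp add: C std_struct_def space_struct_def)
next
  case (LNeg \<phi>)
  then show ?case by simp
next
  case (LConj \<phi> \<psi>)
  have "lfm_sat std_struct v w' \<phi>" "lfm_sat std_struct v w' \<psi>"
    by (rule LConj.IH(1)[where w = w] LConj.IH(2)[where w = w];
        use LConj.prems in \<open>auto simp: eventually_conj_iff\<close>)+
  then show ?case by simp
next
  case (LDisj \<phi> \<psi>)
  from LDisj.prems(6) have "eventually (\<lambda>i. lfm_sat (M i) (\<lambda>x. v x i) (\<lambda>y. w y i) \<phi>) U \<or>
    eventually (\<lambda>i. lfm_sat (M i) (\<lambda>x. v x i) (\<lambda>y. w y i) \<psi>) U"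
    by (simp add: ultrafilter_disj_iff[OF ultra])
  then show ?case using LDisj.IH[OF LDisj.prems(1-3)] LDisj.prems(4,5) by auto
next
  case (HForall x \<phi>)
  have "lfm_sat std_struct (v(x := a)) w' \<phi>" if a: "a \<in> univ N" for a
  proof (rule HForall.IH[OF _ HForall.prems(2,3)])
    show "range (v(x := a)) \<subseteq> univ N" using HForall.prems(1) a by auto
    have "(\<lambda>y. (v(x := a)) y i) = (\<lambda>y. v y i)(x := a i)" for i by auto
    then show "eventually (\<lambda>i. lfm_sat (M i) (\<lambda>y. (v(x := a)) y i) (\<lambda>y. w y i) \<phi>) U"
      using HForall.prems(6) ultraproduct_univ_component[OF a]
      by (auto elim!: eventually_mono)
  qed (use HForall.prems in auto)
  then show ?case by (simp add: std_struct_def)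
next
  case (HExists x \<phi>)
  let ?sat = "\<lambda>i a. lfm_sat (M i) ((\<lambda>y. v y i)(x := a)) (\<lambda>y. w y i) \<phi>"
  have "\<exists>a\<in>univ (home (M i)). (\<exists>a\<in>univ (home (M i)). ?sat i a) \<longrightarrow> ?sat i a" for i
    using fo_structure_ex[OF structures(1)[of i]] by blast
  then obtain a where a: "\<And>i. a i \<in> univ (home (M i))"
    "\<And>i. \<exists>a\<in>univ (home (M i)). ?sat i a \<Longrightarrow> ?sat i (a i)" by metis
  let ?b = "uprod_rep U (\<lambda>i. home (M i)) a"
  note b = uprod_rep[of a "\<lambda>i. home (M i)" U, OF a(1)]
  have "lfm_sat std_struct (v(x := ?b)) w' \<phi>"
  proof (rule HExists.IH[OF _ HExists.prems(2,3)])
    show "range (v(x := ?b)) \<subseteq> univ N" using HExists.prems(1) b(3) by auto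
    have "(\<lambda>y. (v(x := ?b)) y i) = (\<lambda>y. v y i)(x := ?b i)" for i by auto
    moreover have "eventually (\<lambda>i. ?sat i (?b i)) U"
      using HExists.prems(6) b(2) by eventually_elim (use a(2) in force)
    ultimately show "eventually (\<lambda>i. lfm_sat (M i) (\<lambda>y. (v(x := ?b)) y i) (\<lambda>y. w y i) \<phi>) U" by simp
  qed (use HExists.prems in auto)
  then show ?case using b(3) by (auto simp: std_struct_def)
next
  case (SForall y \<phi>)
  have "lfm_sat std_struct v (w'(y := s)) \<phi>" if s: "s \<in> topspace S" for s
  proof (rule SForall.IH[OF SForall.prems(1), where w = "w(y := const s)"])
    have "(\<lambda>z. (w(y := const s)) z i) = (\<lambda>z. w z i)(y := const s i)" for i by auto
    then show "eventually (\<lambda>i. lfm_sat (M i) (\<lambda>x. v x i) (\<lambda>z. (w(y := const s)) z i) \<phi>) U"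
      using SForall.prems(6) const_in_univ[OF s] by (auto elim!: eventually_mono)
  qed (use SForall.prems s const_in_univ std_const in auto)
  then show ?case by (simp add: std_struct_def space_struct_def)
next
  case (SExists y \<phi>)
  let ?sat = "\<lambda>i e. lfm_sat (M i) (\<lambda>x. v x i) ((\<lambda>z. w z i)(y := e)) \<phi>"
  have "\<exists>e\<in>univ (K i). (\<exists>e\<in>univ (K i). ?sat i e) \<longrightarrow> ?sat i e" for i
    using fo_structure_ex[OF structures(2)[of i]] by blast
  then obtain e where e: "\<And>i. e i \<in> univ (K i)"
    "\<And>i. \<exists>e\<in>univ (K i). ?sat i e \<Longrightarrow> ?sat i (e i)" by metis
  \<comment> \<open>The nonstandard witnesses are replaced by their standard part, which is the
    witness in \<open>S\<close>.\<close>
  obtain s where s: "std e s" using std_exists e(1) by blast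
  have "lfm_sat std_struct v (w'(y := s)) \<phi>"
  proof (rule SExists.IH[OF SExists.prems(1), where w = "w(y := e)"])
    have "(\<lambda>z. (w(y := e)) z i) = (\<lambda>z. w z i)(y := e i)" for i by auto
    then show "eventually (\<lambda>i. lfm_sat (M i) (\<lambda>x. v x i) (\<lambda>z. (w(y := e)) z i) \<phi>) U"
      using SExists.prems(6) e(2) by (auto elim!: eventually_mono)
  qed (use SExists.prems s e(1) in auto)
  then show ?case using s by (auto simp: std_struct_def space_struct_def std_def)
qed

lemma lmodels_std_struct:
  assumes "\<And>\<phi>. \<phi> \<in> T \<Longrightarrow> wf_lfm S L \<phi> \<and> positive_lfm \<phi> \<and> eventually (\<lambda>i. lmodels (M i) {\<phi>}) U"
  shows "lmodels std_struct T"
  unfolding lmodels_def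
proof (intro ballI allI impI)
  fix \<phi> and v :: "nat \<Rightarrow> 'i \<Rightarrow> 'h" and w :: "nat \<Rightarrow> 's"
  assume \<phi>: "\<phi> \<in> T"
    and "range v \<subseteq> univ (home std_struct) \<and> range w \<subseteq> univ (space_sort std_struct)"
  then have v: "range v \<subseteq> univ N" and w: "\<And>y. w y \<in> topspace S"
    by (auto simp: std_struct_def space_struct_def)
  have "range (\<lambda>x. v x i) \<subseteq> univ (home (M i))" for i
    using v ultraproduct_univ_component[of _ U "\<lambda>i. home (M i)"] by auto
  moreover have "range (\<lambda>y. const (w y) i) \<subseteq> univ (K i)" for i using const_in_univ w by auto
  ultimately have "eventually (\<lambda>i. lfm_sat (M i) (\<lambda>x. v x i) (\<lambda>y. const (w y) i) \<phi>) U"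
    using assms[OF \<phi>] by (auto simp: lmodels_def elim!: eventually_mono)
  then show "lfm_sat std_struct v w \<phi>"
    using assms[OF \<phi>] v w const_in_univ std_const
    by (intro positive_lfm_sat_std_struct[where w = "\<lambda>y. const (w y)"]) auto
qed

end

theorem theorem2p6:
  fixes S :: "'s topology"
    and L :: "('f, 'p, 'g) lang"
    and T :: "('f, 'p, 'g, 's) lfm set"
  assumes "compact_space S" and "Hausdorff_space S"
    and "\<forall>\<phi>\<in>T. lsentence S L \<phi> \<and> positive_lfm \<phi>"
    and "unif_fin_consistent TYPE('h) TYPE('e) S L T"
  shows "standardly_consistent TYPE(('f, 'p, 'g, 's) lfm set \<Rightarrow> 'h) S L T"
proof -
  obtain \<Delta> where \<Delta>: "\<And>T0. finite T0 \<Longrightarrow> T0 \<subseteq> T \<Longrightarrow>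
    \<exists>M :: ('f, 'p, 'g, 's, 'h, 'e) lstruct. lstructure S L M \<and> modulus S L M \<Delta> \<and> lmodels M T0"
    using assms(4) unfolding unif_fin_consistent_def by blast
  \<comment> \<open>The family has to be total with the same modulus, so every index that is not a
    finite subset of \<open>T\<close> receives a model of the empty theory.\<close>
  have "\<forall>i. \<exists>M :: ('f, 'p, 'g, 's, 'h, 'e) lstruct. lstructure S L M \<and> modulus S L M \<Delta> \<and>
    (finite i \<and> i \<subseteq> T \<longrightarrow> lmodels M i)"
    using \<Delta> by (metis empty_subsetI finite.emptyI)
  then obtain M :: "('f, 'p, 'g, 's) lfm set \<Rightarrow> ('f, 'p, 'g, 's, 'h, 'e) lstruct"
    where M: "\<And>i. lstructure S L (M i)" "\<And>i. modulus S L (M i) \<Delta>"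
      "\<And>i. finite i \<Longrightarrow> i \<subseteq> T \<Longrightarrow> lmodels (M i) i" by metis
  obtain U where U: "ultrafilter U" "U \<le> finite_subsets_at_top T"
    using ultrafilter_below[OF finite_subsets_at_top_neq_bot] by blast
  interpret standard_part S L U M \<Delta>
    using assms(1,2) U(1) M(1,2) by unfold_locales
  have "eventually (\<lambda>i. lmodels (M i) {\<phi>}) U" if "\<phi> \<in> T" for \<phi>
  proof -
    \<comment> \<open>Every finite subset of \<open>T\<close> containing \<open>\<phi>\<close>
      indexes a model of \<open>\<phi>\<close>, and these subsets form an event of this filter,
      hence of \<open>U\<close>.\<close>
    have "eventually (\<lambda>i. lmodels (M i) {\<phi>}) (finite_subsets_at_top T)"
      unfolding eventually_finite_subsets_at_top
      using that M(3) by (intro exI[of _ "{\<phi>}"]) (auto simp: lmodels_def)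
    then show ?thesis using U(2) filter_leD by blast
  qed
  then have "lmodels std_struct T"
    using assms(3) by (intro lmodels_std_struct) (auto simp: lsentence_def)
  then show ?thesis
    using standard_structure_std_struct unfolding standardly_consistent_def by blast
qed

end
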